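(* Let $E,F$ be complex Banach spaces, $U$ an open subset of $E$, $\varphi\in(\Delta(U)\otimes F)'$ (a linear functional on $\Delta(U)\otimes F$), $C>0$ and $1<p\leq\infty$. The following conditions are equivalent: (i) $|\varphi(u)|\leq C\,g_p(u)$ for all $u\in\Delta(U)\otimes F$. (ii) For any representation $\sum_{i=1}^n\lambda_i\delta(x_i)\otimes y_i$ of $u\in\Delta(U)\otimes F$ (with $\lambda_i\in\mathbb{C}$, $x_i\in U$, $y_i\in F$), we have $$\sum_{i=1}^n|\varphi(\lambda_i\delta(x_i)\otimes y_i)|\leq C\,g_p(u).$$ (iii) There exists a Borel regular probability measure $\mu$ on $B_{F^*}$ (with the weak* topology) such that $$|\varphi(\lambda\delta(x)\otimes y)|\leq C|\lambda|\,\|y\|_{L_{p^*}(\mu)}$$ for all $\lambda\in\mathbb{C}$, $x\in U$ and $y\in F$, where $\|y\|_{L_{p^*}(\mu)}=\left(\int_{B_{F^*}}|y^*(y)|^{p^*}\,d\mu(y^* )\right)^{1/p^*}$.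
   Context: $\mathcal{H}^\infty(U,F^* )$ is the space of bounded holomorphic mappings $U\to F^*$. For $x\in U$, $y\in F$, $\delta(x)\otimes y$ is the linear functional on $\mathcal{H}^\infty(U,F^* )$ given by $(\delta(x)\otimes y)(f)=\langle f(x),y\rangle$; $\Delta(U)\otimes F$ is the linear span of all these functionals in the algebraic dual of $\mathcal{H}^\infty(U,F^* )$. $X'$ denotes the algebraic dual, $B_X$ the closed unit ball of $X$, $p^*$ the conjugate index of $p$ ($\infty^*=1$). The Chevet–Saphar norm $g_p$ on $\Delta(U)\otimes F$ is $$g_p(u)=\inf\left\{\|(\lambda_i)_{i=1}^n\|_{\ell_p^n}\,\|(y_i)_{i=1}^n\|_{\ell_{p^*}^{n,w}(F)}:u=\sum_{i=1}^n\lambda_i\delta(x_i)\otimes y_i\right\},$$ where $\|(\lambda_i)\|_{\ell_p^n}=(\sum_i|\lambda_i|^p)^{1/p}$ ($\max_i|\lambda_i|$ if $p=\infty$) and $\|(y_i)\|_{\ell_{p^*}^{n,w}(F)}=\sup_{y^*\in B_{F^*}}(\sum_i|y^*(y_i)|^{p^*})^{1/p^*}$.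
   Formalization: In (ii) the bound C g_p(u) is replaced by C‖(λ_i)‖_p ‖(y_i)‖_{p*,w} of the given representation, since the printed (ii) applied to 0 = δ(x)⊗y − δ(x)⊗y forces φ = 0, while (i) and (iii) hold for nonzero φ. *)

theory Defs
  imports "HOL-Probability.Probability" "HOL-Library.Function_Algebras"
begin

section \<open>Complex Banach spaces\<close>

class complex_vector = ab_group_add +
  fixes scaleC :: "complex \<Rightarrow> 'a \<Rightarrow> 'a" (infixr "*\<^sub>C" 75)
  assumes scaleC_add_right: "c *\<^sub>C (x + y) = c *\<^sub>C x + c *\<^sub>C y"
    and scaleC_add_left: "(c + d) *\<^sub>C x = c *\<^sub>C x + d *\<^sub>C x"
    and scaleC_scaleC: "c *\<^sub>C (d *\<^sub>C x) = (c * d) *\<^sub>C x"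
    and scaleC_one: "1 *\<^sub>C x = x"

global_interpretation complex_vector: vector_space "scaleC :: complex \<Rightarrow> 'a \<Rightarrow> 'a::complex_vector"
  by standard (simp_all add: scaleC_add_right scaleC_add_left scaleC_scaleC scaleC_one)

class complex_normed_vector = complex_vector + real_normed_vector +
  assumes scaleR_scaleC: "r *\<^sub>R x = complex_of_real r *\<^sub>C x"
    and norm_scaleC: "norm (c *\<^sub>C x) = cmod c * norm x"

class complex_banach = complex_normed_vector + complete_space

instantiation complex :: complex_banach
begin
definition scaleC_complex :: "complex \<Rightarrow> complex \<Rightarrow> complex" where
  "scaleC_complex c z = c * z"
instance
  by standard (simp_all add: scaleC_complex_def algebra_simps norm_mult scaleR_conv_of_real)
end

instantiation "fun" :: (type, complex_vector) complex_vector
begin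
definition scaleC_fun :: "complex \<Rightarrow> ('a \<Rightarrow> 'b) \<Rightarrow> 'a \<Rightarrow> 'b" where
  "scaleC_fun c f = (\<lambda>x. c *\<^sub>C f x)"
instance
  by standard
    (simp_all add: scaleC_fun_def fun_eq_iff scaleC_add_right scaleC_add_left scaleC_scaleC scaleC_one)
end

lemma bounded_linear_scaleC_right: "bounded_linear (\<lambda>x::'a::complex_normed_vector. c *\<^sub>C x)"
proof (rule bounded_linear_intro[where K = "cmod c"])
  fix x y :: 'a and r :: real
  show "c *\<^sub>C (x + y) = c *\<^sub>C x + c *\<^sub>C y" by (rule scaleC_add_right)
  show "c *\<^sub>C (r *\<^sub>R x) = r *\<^sub>R (c *\<^sub>C x)"
    by (simp add: scaleR_scaleC scaleC_scaleC mult.commute)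
  show "norm (c *\<^sub>C x) \<le> norm x * cmod c" by (simp add: norm_scaleC mult.commute)
qed

instantiation blinfun :: (real_normed_vector, complex_normed_vector) complex_normed_vector
begin
definition scaleC_blinfun :: "complex \<Rightarrow> ('a \<Rightarrow>\<^sub>L 'b) \<Rightarrow> 'a \<Rightarrow>\<^sub>L 'b" where
  "scaleC_blinfun c g = Blinfun (\<lambda>y. c *\<^sub>C blinfun_apply g y)"

lemma blinfun_apply_scaleC: "blinfun_apply (c *\<^sub>C g) y = c *\<^sub>C blinfun_apply g y"
  unfolding scaleC_blinfun_def
  by (subst bounded_linear_Blinfun_apply)
    (auto intro: bounded_linear_compose[OF bounded_linear_scaleC_right] blinfun.bounded_linear_right)

instance
proof
  fix c d :: complex and r :: real and g h :: "'a \<Rightarrow>\<^sub>L 'b"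
  show "c *\<^sub>C (g + h) = c *\<^sub>C g + c *\<^sub>C h"
    by (rule blinfun_eqI) (simp add: blinfun_apply_scaleC blinfun.add_left scaleC_add_right)
  show "(c + d) *\<^sub>C g = c *\<^sub>C g + d *\<^sub>C g"
    by (rule blinfun_eqI) (simp add: blinfun_apply_scaleC blinfun.add_left scaleC_add_left)
  show "c *\<^sub>C d *\<^sub>C g = (c * d) *\<^sub>C g"
    by (rule blinfun_eqI) (simp add: blinfun_apply_scaleC scaleC_scaleC)
  show "1 *\<^sub>C g = g"
    by (rule blinfun_eqI) (simp add: blinfun_apply_scaleC scaleC_one)
  show "r *\<^sub>R g = complex_of_real r *\<^sub>C g"
    by (rule blinfun_eqI) (simp add: blinfun_apply_scaleC blinfun.scaleR_left scaleR_scaleC)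
  have le: "norm (a *\<^sub>C k) \<le> cmod a * norm k" for a and k :: "'a \<Rightarrow>\<^sub>L 'b"
    by (rule norm_blinfun_bound)
      (simp_all add: blinfun_apply_scaleC norm_scaleC mult.assoc mult_left_mono norm_blinfun)
  show "norm (c *\<^sub>C g) = cmod c * norm g"
  proof (cases "c = 0")
    case True
    then show ?thesis using le[of c g] by simp
  next
    case False
    have "g = inverse c *\<^sub>C (c *\<^sub>C g)"
      using False
      by (intro blinfun_eqI) (simp add: blinfun_apply_scaleC scaleC_scaleC scaleC_one)
    then have "norm g \<le> inverse (cmod c) * norm (c *\<^sub>C g)"
      using le[of "inverse c" "c *\<^sub>C g"] by (simp only: norm_inverse)
    then show ?thesis
      using le[of c g] False by (simp add: norm_divide field_simps)
  qed
qed
end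

definition clinear_on :: "'a::complex_vector set \<Rightarrow> ('a \<Rightarrow> 'b::complex_vector) \<Rightarrow> bool" where
  "clinear_on V f \<longleftrightarrow>
     (\<forall>u\<in>V. \<forall>v\<in>V. f (u + v) = f u + f v) \<and> (\<forall>c. \<forall>u\<in>V. f (c *\<^sub>C u) = c *\<^sub>C f u)"

section \<open>Dual space and weak* topology\<close>

text \<open>The dual \<open>F*\<close> is the closed complex subspace of complex-linear elements of the space of
  bounded real-linear maps into the complex numbers; the norm of the latter restricts to the
  usual dual norm.\<close>

definition cdual :: "('b::complex_normed_vector \<Rightarrow>\<^sub>L complex) set" where
  "cdual = {g. clinear_on UNIV (blinfun_apply g)}"

definition cdual_ball :: "('b::complex_normed_vector \<Rightarrow>\<^sub>L complex) set" where
  "cdual_ball = {g \<in> cdual. norm g \<le> 1}"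

definition weak_star_ball :: "('b::complex_normed_vector \<Rightarrow>\<^sub>L complex) topology" where
  "weak_star_ball =
     pullback_topology cdual_ball blinfun_apply (product_topology (\<lambda>_. euclidean) UNIV)"

definition regular_borel_prob :: "'a topology \<Rightarrow> 'a measure \<Rightarrow> bool" where
  "regular_borel_prob X M \<longleftrightarrow>
     prob_space M \<and> space M = topspace X \<and>
     sets M = sigma_sets (topspace X) {S. openin X S} \<and>
     (\<forall>A\<in>sets M. emeasure M A = (SUP K\<in>{K. compactin X K \<and> K \<subseteq> A}. emeasure M K)) \<and>
     (\<forall>A\<in>sets M. emeasure M A = (INF G\<in>{G. openin X G \<and> A \<subseteq> G}. emeasure M G))"

section \<open>Bounded holomorphic mappings and the space \<open>\<Delta>(U) \<otimes> F\<close>\<close>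

definition cholomorphic_on ::
    "('a::complex_normed_vector \<Rightarrow> 'c::complex_normed_vector) \<Rightarrow> 'a set \<Rightarrow> bool" where
  "cholomorphic_on f U \<longleftrightarrow>
     (\<forall>x\<in>U. \<exists>D. (f has_derivative D) (at x) \<and> clinear_on UNIV D)"

text \<open>Mappings on \<open>U\<close> are represented by total functions vanishing outside \<open>U\<close>.\<close>

definition Hinf :: "'a::complex_normed_vector set \<Rightarrow> 'c::complex_normed_vector set \<Rightarrow> ('a \<Rightarrow> 'c) set" where
  "Hinf U G = {f. cholomorphic_on f U \<and> f ` U \<subseteq> G \<and> bounded (f ` U) \<and> (\<forall>x. x \<notin> U \<longrightarrow> f x = 0)}"

text \<open>Functionals on \<open>Hinf U cdual\<close> are represented by functions vanishing outside that set, so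
  that equality of functions is equality of functionals.\<close>

definition delta_tensor ::
    "'a::complex_normed_vector set \<Rightarrow> 'a \<Rightarrow> 'b::complex_normed_vector
       \<Rightarrow> (('a \<Rightarrow> ('b \<Rightarrow>\<^sub>L complex)) \<Rightarrow> complex)" where
  "delta_tensor U x y = (\<lambda>f. if f \<in> Hinf U cdual then blinfun_apply (f x) y else 0)"

definition Delta_tensor ::
    "'a::complex_normed_vector set
       \<Rightarrow> (('a \<Rightarrow> ('b::complex_normed_vector \<Rightarrow>\<^sub>L complex)) \<Rightarrow> complex) set" where
  "Delta_tensor U = complex_vector.span {delta_tensor U x y | x y. x \<in> U}"

section \<open>The Chevet--Saphar norm\<close>

text \<open>With the conventions of \<^typ>\<open>ennreal\<close> this maps \<open>1\<close> to \<open>\<infinity>\<close> and \<open>\<infinity>\<close> to \<open>1\<close>.\<close>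

definition conj_index :: "ennreal \<Rightarrow> ennreal" where
  "conj_index p = inverse (1 - inverse p)"

lemma conj_index_top: "conj_index \<top> = 1"
  by (simp add: conj_index_def)

lemma conj_index_1: "conj_index 1 = \<top>"
  by (simp add: conj_index_def)

lemma conj_index_ennreal:
  assumes "1 < r"
  shows "conj_index (ennreal r) = ennreal (r / (r - 1))"
proof -
  have "1 - inverse (ennreal r) = ennreal (1 - inverse r)"
    using assms by (simp add: inverse_ennreal ennreal_minus flip: ennreal_1)
  moreover have "0 < 1 - inverse r"
    using assms by (simp add: field_simps)
  moreover have "inverse (1 - inverse r) = r / (r - 1)"
    using assms by (simp add: field_simps)
  ultimately show ?thesis
    by (simp add: conj_index_def inverse_ennreal)
qed

definition lp_norm :: "ennreal \<Rightarrow> nat \<Rightarrow> (nat \<Rightarrow> complex) \<Rightarrow> real" where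
  "lp_norm p n a =
     (if p = \<top> then Max (insert 0 ((\<lambda>i. cmod (a i)) ` {..<n}))
      else (\<Sum>i<n. cmod (a i) powr enn2real p) powr (1 / enn2real p))"

definition weak_lp_norm :: "ennreal \<Rightarrow> nat \<Rightarrow> (nat \<Rightarrow> 'b::complex_normed_vector) \<Rightarrow> real" where
  "weak_lp_norm q n y = (SUP g\<in>cdual_ball. lp_norm q n (\<lambda>i. blinfun_apply g (y i)))"

definition tensor_sum ::
    "'a::complex_normed_vector set \<Rightarrow> nat \<Rightarrow> (nat \<Rightarrow> complex) \<Rightarrow> (nat \<Rightarrow> 'a)
       \<Rightarrow> (nat \<Rightarrow> 'b::complex_normed_vector) \<Rightarrow> (('a \<Rightarrow> ('b \<Rightarrow>\<^sub>L complex)) \<Rightarrow> complex)" where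
  "tensor_sum U n l x y = (\<Sum>i<n. l i *\<^sub>C delta_tensor U (x i) (y i))"

definition chevet_saphar ::
    "ennreal \<Rightarrow> 'a::complex_normed_vector set
       \<Rightarrow> (('a \<Rightarrow> ('b::complex_normed_vector \<Rightarrow>\<^sub>L complex)) \<Rightarrow> complex) \<Rightarrow> real" where
  "chevet_saphar p U u =
     Inf {lp_norm p n l * weak_lp_norm (conj_index p) n y | n l x y.
            (\<forall>i<n. x i \<in> U) \<and> u = tensor_sum U n l x y}"

definition Lq_norm :: "('b::complex_normed_vector \<Rightarrow>\<^sub>L complex) measure \<Rightarrow> ennreal \<Rightarrow> 'b \<Rightarrow> real" where
  "Lq_norm M q y =
     (LINT g|M. cmod (blinfun_apply g y) powr enn2real q) powr (1 / enn2real q)"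

text \<open>If, in the second condition of the theorem, the bound for an arbitrary representation of
  \<open>u\<close> were \<open>C * chevet_saphar p U u\<close>, independent of the representation, that condition would
  force \<open>\<phi> = 0\<close>, because \<open>0 = \<delta>(x) \<otimes> y - \<delta>(x) \<otimes> y\<close>
  (see \<open>representation_independent_bound_imp_zero\<close> below). It is therefore read with the quantity
  \<open>lp_norm p n l * weak_lp_norm (conj_index p) n y\<close> attached to the given representation, whose
  infimum over all representations is \<open>chevet_saphar p U u\<close>.\<close>

lemma lp_norm_mono:
  assumes "\<And>i. i < n \<Longrightarrow> cmod (a i) \<le> cmod (b i)"
  shows "lp_norm p n a \<le> lp_norm p n b"
proof (cases "p = \<top>")
  case True
  have "Max (insert 0 ((\<lambda>i. cmod (a i)) ` {..<n})) \<le> Max (insert 0 ((\<lambda>i. cmod (b i)) ` {..<n}))"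
    using assms by (fastforce simp: Max_ge_iff intro!: Max.boundedI)
  then show ?thesis by (simp add: lp_norm_def True)
next
  case False
  then show ?thesis
    by (auto simp: lp_norm_def assms intro!: powr_mono2 sum_mono sum_nonneg)
qed

lemma lp_norm_nonneg: "0 \<le> lp_norm p n a"
  by (simp add: lp_norm_def)

lemma bdd_above_weak_lp_norm:
  "bdd_above ((\<lambda>g. lp_norm q n (\<lambda>i. blinfun_apply g (y i))) ` cdual_ball)"
proof (rule bdd_aboveI2)
  fix g :: "'a \<Rightarrow>\<^sub>L complex" assume g: "g \<in> cdual_ball"
  show "lp_norm q n (\<lambda>i. blinfun_apply g (y i)) \<le> lp_norm q n (\<lambda>i. complex_of_real (norm (y i)))"
  proof (rule lp_norm_mono)
    fix i
    have "cmod (blinfun_apply g (y i)) \<le> norm g * norm (y i)" by (rule norm_blinfun)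
    also have "\<dots> \<le> 1 * norm (y i)"
      using g by (intro mult_right_mono) (auto simp: cdual_ball_def)
    finally show "cmod (blinfun_apply g (y i)) \<le> cmod (complex_of_real (norm (y i)))" by simp
  qed
qed

lemma zero_mem_cdual_ball: "0 \<in> cdual_ball"
  by (simp add: cdual_ball_def cdual_def clinear_on_def scaleC_complex_def)

lemma weak_lp_norm_nonneg: "0 \<le> weak_lp_norm q n y"
  unfolding weak_lp_norm_def
  by (rule cSUP_upper2[OF bdd_above_weak_lp_norm zero_mem_cdual_ball lp_norm_nonneg])

lemma chevet_saphar_le:
  assumes "\<And>i. i < n \<Longrightarrow> x i \<in> U" and "u = tensor_sum U n l x y"
  shows "chevet_saphar p U u \<le> lp_norm p n l * weak_lp_norm (conj_index p) n y"
  unfolding chevet_saphar_def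
proof (rule cInf_lower)
  show "bdd_below {lp_norm p n l * weak_lp_norm (conj_index p) n y | n l x y.
          (\<forall>i<n. x i \<in> U) \<and> u = tensor_sum U n l x y}"
    by (rule bdd_belowI[of _ 0]) (auto intro: mult_nonneg_nonneg lp_norm_nonneg weak_lp_norm_nonneg)
qed (use assms in blast)

lemma representation_independent_bound_imp_zero:
  assumes bound: "\<And>u n l x y. u \<in> Delta_tensor U \<Longrightarrow> (\<forall>i<n. x i \<in> U) \<Longrightarrow> u = tensor_sum U n l x y \<Longrightarrow>
      (\<Sum>i<n. cmod (\<phi> (l i *\<^sub>C delta_tensor U (x i) (y i)))) \<le> C * chevet_saphar p U u"
    and "0 < C" and "x \<in> U"
  shows "\<phi> (c *\<^sub>C delta_tensor U x y) = 0"
proof -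
  define l where "l = (\<lambda>i::nat. if i = 0 then c else - c)"
  have 0: "0 = tensor_sum U 2 l (\<lambda>_. x) (\<lambda>_. y)"
    by (simp add: tensor_sum_def l_def numeral_2_eq_2)
  have "0 = tensor_sum U 0 l (\<lambda>_. x) (\<lambda>_. y)"
    by (simp add: tensor_sum_def)
  then have "chevet_saphar p U (0 :: ('a \<Rightarrow> 'b \<Rightarrow>\<^sub>L complex) \<Rightarrow> complex)
      \<le> lp_norm p 0 l * weak_lp_norm (conj_index p) 0 (\<lambda>_. y)"
    by (intro chevet_saphar_le[where x = "\<lambda>_. x"]) auto
  also have "\<dots> = 0"
    by (simp add: lp_norm_def)
  finally have "C * chevet_saphar p U (0 :: ('a \<Rightarrow> 'b \<Rightarrow>\<^sub>L complex) \<Rightarrow> complex) \<le> 0"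
    using \<open>0 < C\<close> by (rule mult_nonneg_nonpos[OF less_imp_le, rotated])
  moreover have "(\<Sum>i<2. cmod (\<phi> (l i *\<^sub>C delta_tensor U x y)))
      \<le> C * chevet_saphar p U (0 :: ('a \<Rightarrow> 'b \<Rightarrow>\<^sub>L complex) \<Rightarrow> complex)"
    by (rule bound[OF _ _ 0]) (simp_all add: Delta_tensor_def complex_vector.span_zero \<open>x \<in> U\<close>)
  ultimately have "cmod (\<phi> (c *\<^sub>C delta_tensor U x y)) + cmod (\<phi> ((- c) *\<^sub>C delta_tensor U x y)) \<le> 0"
    by (simp add: l_def numeral_2_eq_2)
  then show ?thesis
    by (smt (verit) norm_ge_zero norm_eq_zero)
qed

end

theory Submission
  imports Defs
begin

text \<open>
  Write \<open>q\<close> for the conjugate index of \<open>p\<close>, so that \<open>1 \<le> q < \<infinity>\<close>, and \<open>K\<close> for the dual unit ball with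
  its weak* topology.

  The first two conditions are equivalent because \<open>\<ell>\<^sub>p\<close> norms do not see the phases of the scalars:
  multiplying each \<open>\<lambda>\<^sub>i\<close> by a unimodular number turns \<open>\<phi>(u)\<close> into the sum of the absolute values
  \<open>|\<phi>(\<lambda>\<^sub>i \<delta>(x\<^sub>i) \<otimes> y\<^sub>i)|\<close> without changing the cost of the representation; conversely the triangle
  inequality and an infimum over representations suffice (lemma \<open>chevet_saphar_bound_iff\<close>).
  The measure implies the sum estimate by Hoelder's inequality and by integrating
  \<open>\<Sum>|g(y\<^sub>i)|\<^sup>q\<close> over \<open>K\<close>, whose supremum is the \<open>q\<close>-th power of the weak norm
  (lemma \<open>measure_imp_abs_dominated\<close>).

  The substance is the existence of the measure, a domination argument of Pietsch type. Choosing
  \<open>\<lambda>\<^sub>i = |\<phi>(\<delta>(x\<^sub>i) \<otimes> y\<^sub>i)|\<^bsup>q-1\<^esup>\<close>, the extremal weights in Hoelder's inequality, the sum estimate says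
  that every finite nonnegative combination of the functions \<open>|g(y)|\<^sup>q - |\<phi>(\<delta>(x) \<otimes> y)|\<^sup>q / C\<^sup>q\<close> is
  nonnegative somewhere on \<open>K\<close> (lemma \<open>abs_dominated_pointwise\<close>). A minimax theorem then gives one
  regular Borel probability measure for which all these functions have nonnegative integral (theorem
  \<open>regular_measure_domination\<close>).

  The minimax theorem holds on any nonempty compact Hausdorff space. Finitely additive means on all \<open>[0,1]\<close>-valued functions form a convex set that
  is compact for pointwise convergence. For finitely many inequalities, a mean that minimises the
  sum of the squared defects satisfies them all, since otherwise moving it slightly towards a
  suitable point evaluation would decrease that sum; compactness of the set of means passes to all
  inequalities at once (lemma \<open>mean_domination\<close>). A mean restricted to indicators of closed sets is a
  content, and Caratheodory's construction turns a content into a regular Borel measure that is at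
  least as large on closed sets. Superlevel sets of a continuous function are closed, so slicing the
  function horizontally shows that the measure integrates it to at least its mean (lemma
  \<open>mean_le_integral\<close>).
\<close>

section \<open>Regular Borel measures from contents on compact spaces\<close>

text \<open>Contents are prescribed on closed sets only, because these are the sets on which the content
  constructed below is compared with the measure. Compactness of the space makes closed sets
  compact, which is where countable subadditivity comes from.\<close>

locale compact_content =
  fixes X :: "'a topology" and \<nu> :: "'a set \<Rightarrow> ennreal"
  assumes compact: "compact_space X" and Hausdorff: "Hausdorff_space X"
    and content_empty: "\<nu> {} = 0"
    and content_mono: "\<lbrakk>closedin X K; closedin X L; K \<subseteq> L\<rbrakk> \<Longrightarrow> \<nu> K \<le> \<nu> L"
    and content_subadditive: "\<lbrakk>closedin X K; closedin X L\<rbrakk> \<Longrightarrow> \<nu> (K \<union> L) \<le> \<nu> K + \<nu> L"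
    and content_additive: "\<lbrakk>closedin X K; closedin X L; K \<inter> L = {}\<rbrakk> \<Longrightarrow> \<nu> (K \<union> L) = \<nu> K + \<nu> L"
    and content_total: "\<nu> (topspace X) = 1"
begin

definition open_content :: "'a set \<Rightarrow> ennreal" where
  "open_content G = (SUP K\<in>{K. closedin X K \<and> K \<subseteq> G}. \<nu> K)"

definition outer_content :: "'a set \<Rightarrow> ennreal" where
  "outer_content A = (INF G\<in>{G. openin X G \<and> A \<subseteq> G}. open_content G)"

lemma content_le_open_content: "closedin X K \<Longrightarrow> K \<subseteq> G \<Longrightarrow> \<nu> K \<le> open_content G"
  unfolding open_content_def by (rule SUP_upper) simp

lemma open_content_mono: "G \<subseteq> H \<Longrightarrow> open_content G \<le> open_content H"
  unfolding open_content_def by (rule SUP_subset_mono) auto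

lemma open_content_empty: "open_content {} = 0"
proof -
  have "{K. closedin X K \<and> K \<subseteq> {}} = {{}}" by auto
  then show ?thesis by (simp add: open_content_def content_empty)
qed

lemma open_content_topspace: "open_content (topspace X) = 1"
proof (rule antisym)
  show "open_content (topspace X) \<le> 1"
    unfolding open_content_def
    by (rule SUP_least) (auto simp flip: content_total intro: content_mono)
  show "1 \<le> open_content (topspace X)"
    by (simp flip: content_total add: content_le_open_content)
qed

text \<open>In a normal space a closed subset of \<open>G \<union> H\<close> is the union of two closed sets, one inside \<open>G\<close> and
  one inside \<open>H\<close>.\<close>

lemma open_content_Un:
  assumes G: "openin X G" and H: "openin X H"
  shows "open_content (G \<union> H) \<le> open_content G + open_content H"
  unfolding open_content_def[of "G \<union> H"]
proof (rule SUP_least, clarify)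
  fix K assume K: "closedin X K" "K \<subseteq> G \<union> H"
  have "normal_space X"
    using compact Hausdorff compact_Hausdorff_or_regular_imp_normal_space by blast
  moreover have "closedin X (K - G)" "closedin X (K - H)" "disjnt (K - G) (K - H)"
    using K G H by (auto simp: disjnt_def closedin_diff)
  ultimately obtain V W where VW: "openin X V" "openin X W" "K - G \<subseteq> V" "K - H \<subseteq> W" "disjnt V W"
    unfolding normal_space_def by meson
  have "K = (K - V) \<union> (K - W)"
    using VW by (auto simp: disjnt_def)
  then have "\<nu> K \<le> \<nu> (K - V) + \<nu> (K - W)"
    using content_subadditive[of "K - V" "K - W"] K VW by (simp add: closedin_diff)
  also have "\<dots> \<le> open_content G + open_content H"
    using K VW by (intro add_mono content_le_open_content closedin_diff) auto
  finally show "\<nu> K \<le> open_content G + open_content H" .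
qed

lemma open_content_UN_finite:
  assumes "finite J" "\<And>i. i \<in> J \<Longrightarrow> openin X (G i)"
  shows "open_content (\<Union>i\<in>J. G i) \<le> (\<Sum>i\<in>J. open_content (G i))"
  using assms
proof (induction J rule: finite_induct)
  case (insert j J)
  then have "open_content (G j \<union> (\<Union>i\<in>J. G i)) \<le> open_content (G j) + open_content (\<Union>i\<in>J. G i)"
    by (intro open_content_Un) auto
  also have "\<dots> \<le> open_content (G j) + (\<Sum>i\<in>J. open_content (G i))"
    using insert by (intro add_left_mono) auto
  finally show ?case using insert by simp
qed (simp add: open_content_empty)

text \<open>A closed set is compact, so it meets the countable union only through finitely many members.\<close>

lemma open_content_UN:
  fixes G :: "nat \<Rightarrow> 'a set"
  assumes G: "\<And>i. openin X (G i)"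
  shows "open_content (\<Union>i. G i) \<le> (\<Sum>i. open_content (G i))"
  unfolding open_content_def[of "\<Union>i. G i"]
proof (rule SUP_least, clarify)
  fix K assume K: "closedin X K" "K \<subseteq> (\<Union>i. G i)"
  then have "compactin X K"
    using compact closedin_compact_space by blast
  then obtain \<F> where "finite \<F>" "\<F> \<subseteq> range G" "K \<subseteq> \<Union>\<F>"
    using K G unfolding compactin_def by (metis (no_types, lifting) imageE)
  then obtain J where J: "finite J" "K \<subseteq> (\<Union>i\<in>J. G i)"
    by (metis finite_subset_image)
  have "\<nu> K \<le> open_content (\<Union>i\<in>J. G i)"
    using K J by (intro content_le_open_content)
  also have "\<dots> \<le> (\<Sum>i\<in>J. open_content (G i))"
    using J G by (intro open_content_UN_finite) auto
  also have "\<dots> \<le> (\<Sum>i. open_content (G i))"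
    using J by (intro sum_le_suminf) auto
  finally show "\<nu> K \<le> (\<Sum>i. open_content (G i))" .
qed

lemma outer_content_open: "openin X G \<Longrightarrow> outer_content G = open_content G"
  unfolding outer_content_def
  by (rule antisym[OF INF_lower INF_greatest]) (auto intro: open_content_mono)

lemma outer_content_mono: "A \<subseteq> B \<Longrightarrow> outer_content A \<le> outer_content B"
  unfolding outer_content_def by (rule INF_superset_mono) auto

lemma outer_measure_space_outer_content:
  "outer_measure_space (Pow (topspace X)) outer_content"
  unfolding outer_measure_space_def
proof (intro conjI)
  show "positive (Pow (topspace X)) outer_content"
    by (simp add: positive_def outer_content_open open_content_empty)
  show "increasing (Pow (topspace X)) outer_content"
    by (simp add: increasing_def outer_content_mono)
  show "countably_subadditive (Pow (topspace X)) outer_content"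
    unfolding countably_subadditive_def
  proof clarify
    fix A :: "nat \<Rightarrow> 'a set"
    show "outer_content (\<Union>i. A i) \<le> (\<Sum>i. outer_content (A i))"
    proof (rule ennreal_le_epsilon)
      fix e :: real
      assume e: "0 < e" and fin: "(\<Sum>i. outer_content (A i)) < top"
      \<comment> \<open>A geometric share of \<open>e\<close> for each set keeps the total excess at most \<open>e\<close>.\<close>
      have *: "outer_content (A n) < outer_content (A n) + e * (1/2)^Suc n" for n
        using e fin by (auto simp add: less_top dest!: ennreal_suminf_lessD)
      have "\<exists>G. openin X G \<and> A n \<subseteq> G \<and> open_content G < outer_content (A n) + e * (1/2)^Suc n" for n
        using *[of n] by (subst (asm) outer_content_def) (auto simp: INF_less_iff)
      then obtain G where G: "\<And>n. openin X (G n)" "\<And>n. A n \<subseteq> G n"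
          "\<And>n. open_content (G n) < outer_content (A n) + e * (1/2)^Suc n"
        by metis
      have "outer_content (\<Union>i. A i) \<le> outer_content (\<Union>i. G i)"
        using G by (intro outer_content_mono) blast
      also have "\<dots> = open_content (\<Union>i. G i)"
        using G by (intro outer_content_open openin_Union) auto
      also have "\<dots> \<le> (\<Sum>i. open_content (G i))"
        by (intro open_content_UN G)
      also have "\<dots> \<le> (\<Sum>n. outer_content (A n) + e * (1/2)^Suc n)"
        using G by (intro suminf_le allI less_imp_le) auto
      also have "\<dots> = (\<Sum>n. outer_content (A n)) + (\<Sum>n. ennreal e * ennreal ((1/2) ^ Suc n))"
        using e by (subst suminf_add[symmetric])
          (auto simp del: ennreal_suminf_cmult simp add: ennreal_mult[symmetric])
      also have "\<dots> = (\<Sum>n. outer_content (A n)) + e"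
        unfolding ennreal_suminf_cmult
        by (subst suminf_ennreal_eq[OF zero_le_power power_half_series]) auto
      finally show "outer_content (\<Union>i. A i) \<le> (\<Sum>n. outer_content (A n)) + e" .
    qed
  qed
qed

text \<open>This is the half of Caratheodory's criterion for \<open>G\<close> that is not subadditivity. Removing from \<open>V\<close> a
  closed set \<open>K \<subseteq> G \<inter> V\<close> leaves an open set that contains \<open>V - G\<close> and whose closed subsets are
  disjoint from \<open>K\<close>, so that the contents add up.\<close>

lemma open_content_split:
  assumes G: "openin X G" and V: "openin X V"
  shows "open_content (G \<inter> V) + outer_content (V - G) \<le> open_content V"
proof -
  have ne: "{K. closedin X K \<and> K \<subseteq> G \<inter> V} \<noteq> {}" by (auto intro: exI[of _ "{}"])
  show ?thesis
    unfolding open_content_def[of "G \<inter> V"] ennreal_SUP_add_left[OF ne, symmetric]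
  proof (rule SUP_least, clarify)
    fix K assume K: "closedin X K" "K \<subseteq> G \<inter> V"
    have VK: "openin X (V - K)"
      using V K by (simp add: openin_diff)
    have "outer_content (V - G) \<le> outer_content (V - K)"
      using K by (intro outer_content_mono) auto
    also have "\<dots> = open_content (V - K)"
      using VK by (rule outer_content_open)
    finally have "\<nu> K + outer_content (V - G) \<le> open_content (V - K) + \<nu> K"
      by (metis add.commute add_right_mono)
    also have "\<dots> \<le> open_content V"
    proof -
      have ne': "{L. closedin X L \<and> L \<subseteq> V - K} \<noteq> {}" by (auto intro: exI[of _ "{}"])
      show ?thesis
        unfolding open_content_def[of "V - K"] ennreal_SUP_add_left[OF ne', symmetric]
      proof (rule SUP_least, clarify)
        fix L assume L: "closedin X L" "L \<subseteq> V - K"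
        then have "\<nu> L + \<nu> K = \<nu> (L \<union> K)"
          using K by (intro content_additive[symmetric]) auto
        also have "\<dots> \<le> open_content V"
          using K L by (intro content_le_open_content closedin_Un) auto
        finally show "\<nu> L + \<nu> K \<le> open_content V" .
      qed
    qed
    finally show "\<nu> K + outer_content (V - G) \<le> open_content V" .
  qed
qed

lemma openin_lambda_system:
  assumes G: "openin X G"
  shows "G \<in> lambda_system (topspace X) (Pow (topspace X)) outer_content"
  unfolding lambda_system_def
proof (safe)
  fix a assume "a \<in> G" then show "a \<in> topspace X" using G openin_subset by blast
next
  fix A assume A: "A \<subseteq> topspace X"
  let ?o = "outer_content"
  have "subadditive (Pow (topspace X)) ?o"
    using outer_measure_space_outer_content unfolding outer_measure_space_def
    by (simp add: ring_of_sets.countably_subadditive_subadditive[OF algebra.axioms(1)[OF algebra_Pow]])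
  then have "?o (G \<inter> A \<union> (topspace X - G) \<inter> A) \<le> ?o (G \<inter> A) + ?o ((topspace X - G) \<inter> A)"
    using A G by (intro subadditiveD) (auto dest: openin_subset)
  moreover have "G \<inter> A \<union> (topspace X - G) \<inter> A = A" using A by auto
  moreover have "?o (G \<inter> A) + ?o ((topspace X - G) \<inter> A) \<le> ?o A"
    unfolding outer_content_def[of A]
  proof (rule INF_greatest, clarify)
    fix V assume V: "openin X V" "A \<subseteq> V"
    have "?o (G \<inter> A) + ?o ((topspace X - G) \<inter> A) \<le> ?o (G \<inter> V) + ?o (V - G)"
      using V by (intro add_mono outer_content_mono) auto
    also have "\<dots> = open_content (G \<inter> V) + ?o (V - G)"
      using G V by (simp add: outer_content_open openin_Int)
    also have "\<dots> \<le> open_content V"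
      by (intro open_content_split G V)
    finally show "?o (G \<inter> A) + ?o ((topspace X - G) \<inter> A) \<le> open_content V" .
  qed
  ultimately show "?o (G \<inter> A) + ?o ((topspace X - G) \<inter> A) = ?o A" by simp
qed

definition content_measure :: "'a measure" where
  "content_measure = measure_of (topspace X) {S. openin X S} outer_content"

lemma space_content_measure: "space content_measure = topspace X"
  unfolding content_measure_def by (rule space_measure_of) (auto dest: openin_subset)

lemma sets_content_measure: "sets content_measure = sigma_sets (topspace X) {S. openin X S}"
  unfolding content_measure_def by (rule sets_measure_of) (auto dest: openin_subset)

lemma emeasure_content_measure:
  assumes "A \<in> sets content_measure"
  shows "emeasure content_measure A = outer_content A"
proof -
  let ?L = "lambda_system (topspace X) (Pow (topspace X)) outer_content"
  have L: "measure_space (topspace X) ?L outer_content"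
    by (rule sigma_algebra.caratheodory_lemma[OF sigma_algebra_Pow outer_measure_space_outer_content])
  then have "sigma_sets (topspace X) {S. openin X S} \<subseteq> ?L"
    by (intro sigma_algebra.sigma_sets_subset)
      (auto simp: measure_space_def openin_lambda_system)
  then have "measure_space (topspace X) (sigma_sets (topspace X) {S. openin X S}) outer_content"
    by (intro measure_down[OF L] sigma_algebra_sigma_sets) (auto dest: openin_subset)
  then show ?thesis
    using assms unfolding sets_content_measure
    by (intro emeasure_measure_of[OF content_measure_def])
      (auto simp: measure_space_def sets_content_measure dest: openin_subset)
qed

lemma openin_sets: "openin X G \<Longrightarrow> G \<in> sets content_measure"
  by (simp add: sets_content_measure sigma_sets.Basic)

lemma closedin_sets: "closedin X K \<Longrightarrow> K \<in> sets content_measure"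
  using openin_sets[of "topspace X - K"] sets.compl_sets[of "topspace X - K" content_measure]
  by (auto simp: space_content_measure closedin_def double_diff)

text \<open>Every open set around \<open>K\<close> has open content at least \<open>\<nu> K\<close>. The inequality can be strict: a finitely
  additive content may live arbitrarily close to a point while giving the point itself no mass,
  and the measure moves that mass into the point.\<close>

lemma content_le_measure: "closedin X K \<Longrightarrow> \<nu> K \<le> emeasure content_measure K"
  by (auto simp: emeasure_content_measure closedin_sets outer_content_def
      intro!: INF_greatest content_le_open_content)

text \<open>Outer regularity is built into the outer content. Inner regularity follows by taking complements,
  the total mass being finite and closed sets being compact.\<close>

lemma regular_content_measure: "regular_borel_prob X content_measure"
proof -
  interpret prob_space content_measure
    by standard (simp add: space_content_measure emeasure_content_measure openin_sets
        outer_content_open open_content_topspace)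
  have outer: "emeasure content_measure A
      = (INF G\<in>{G. openin X G \<and> A \<subseteq> G}. emeasure content_measure G)"
    if "A \<in> sets content_measure" for A
    using that emeasure_content_measure[OF that]
    by (auto simp: outer_content_def[of A] emeasure_content_measure openin_sets outer_content_open
        intro!: INF_cong)
  have inner: "emeasure content_measure A
      = (SUP K\<in>{K. compactin X K \<and> K \<subseteq> A}. emeasure content_measure K)" (is "_ = ?S")
    if A: "A \<in> sets content_measure" for A
  proof (rule antisym)
    show "emeasure content_measure A \<le> ?S"
    proof (rule ennreal_le_epsilon)
      fix e :: real assume e: "0 < e"
      let ?B = "topspace X - A"
      have B: "?B \<in> sets content_measure"
        using A sets.compl_sets[of A content_measure] by (simp add: space_content_measure)
      have "emeasure content_measure ?B < emeasure content_measure ?B + ennreal e"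
        using e by (simp add: emeasure_eq_measure ennreal_less_iff flip: ennreal_plus)
      then obtain G where G: "openin X G" "?B \<subseteq> G"
          "emeasure content_measure G < emeasure content_measure ?B + ennreal e"
        by (subst (asm) outer[OF B]) (auto simp: INF_less_iff)
      define K where "K = topspace X - G"
      have "closedin X K" using G(1) by (simp add: K_def closedin_diff)
      then have "compactin X K" using compact closedin_compact_space by blast
      moreover have "K \<subseteq> A" using G by (auto simp: K_def)
      ultimately have "emeasure content_measure K \<le> ?S"
        by (intro SUP_upper) auto
      moreover have "emeasure content_measure A \<le> emeasure content_measure K + ennreal e"
      proof -
        have "prob G < prob ?B + e"
          using G(3) e by (simp add: emeasure_eq_measure ennreal_less_iff flip: ennreal_plus)
        then have "prob A \<le> prob K + e"
          using prob_compl[OF A] prob_compl[OF openin_sets[OF G(1)]]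
          by (simp add: K_def space_content_measure)
        then show ?thesis
          using e by (simp add: emeasure_eq_measure flip: ennreal_plus)
      qed
      ultimately show "emeasure content_measure A \<le> ?S + ennreal e"
        by (meson add_right_mono order_trans)
    qed
    show "?S \<le> emeasure content_measure A"
      using A by (intro SUP_least emeasure_mono) auto
  qed
  show ?thesis
    unfolding regular_borel_prob_def
    using prob_space_axioms space_content_measure sets_content_measure inner outer by blast
qed

end

section \<open>Finitely additive means\<close>

definition unit_valued_on :: "'a set \<Rightarrow> ('a \<Rightarrow> real) \<Rightarrow> bool" where
  "unit_valued_on \<Omega> f \<longleftrightarrow> (\<forall>x\<in>\<Omega>. 0 \<le> f x \<and> f x \<le> 1)"

text \<open>Finitely additive probabilities on \<open>\<Omega>\<close>, seen as integrals. The value at a function that is not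
  \<open>[0,1]\<close>-valued on \<open>\<Omega>\<close> carries no information; it is merely confined to \<open>[0,1]\<close>, so that the
  whole set lies in a product of compact intervals.\<close>

definition means :: "'a set \<Rightarrow> (('a \<Rightarrow> real) \<Rightarrow> real) set" where
  "means \<Omega> = {m. (\<forall>f. 0 \<le> m f \<and> m f \<le> 1) \<and> m (\<lambda>_. 1) = 1 \<and>
     (\<forall>f g. unit_valued_on \<Omega> f \<longrightarrow> unit_valued_on \<Omega> g \<longrightarrow> unit_valued_on \<Omega> (\<lambda>x. f x + g x) \<longrightarrow>
        m (\<lambda>x. f x + g x) = m f + m g) \<and>
     (\<forall>c f. 0 \<le> c \<longrightarrow> c \<le> 1 \<longrightarrow> unit_valued_on \<Omega> f \<longrightarrow> m (\<lambda>x. c * f x) = c * m f)}"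

lemma mean_nonneg: "m \<in> means \<Omega> \<Longrightarrow> 0 \<le> m f"
  and mean_one: "m \<in> means \<Omega> \<Longrightarrow> m (\<lambda>_. 1) = 1"
  and mean_add: "\<lbrakk>m \<in> means \<Omega>; unit_valued_on \<Omega> f; unit_valued_on \<Omega> g; unit_valued_on \<Omega> (\<lambda>x. f x + g x)\<rbrakk>
    \<Longrightarrow> m (\<lambda>x. f x + g x) = m f + m g"
  and mean_scale: "\<lbrakk>m \<in> means \<Omega>; 0 \<le> c; c \<le> 1; unit_valued_on \<Omega> f\<rbrakk> \<Longrightarrow> m (\<lambda>x. c * f x) = c * m f"
  by (simp_all add: means_def)

lemma mean_mono:
  assumes m: "m \<in> means \<Omega>" and f: "unit_valued_on \<Omega> f" and g: "unit_valued_on \<Omega> g"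
    and le: "\<And>x. x \<in> \<Omega> \<Longrightarrow> f x \<le> g x"
  shows "m f \<le> m g"
proof -
  have "m (\<lambda>x. f x + (g x - f x)) = m f + m (\<lambda>x. g x - f x)"
    using f g le by (intro mean_add[OF m]) (auto simp: unit_valued_on_def algebra_simps intro: add_increasing2)
  then show ?thesis
    using mean_nonneg[OF m, of "\<lambda>x. g x - f x"] by simp
qed

lemma point_mean:
  "x \<in> \<Omega> \<Longrightarrow> (\<lambda>f. if unit_valued_on \<Omega> f then f x else 0) \<in> means \<Omega>"
  by (auto simp: means_def unit_valued_on_def mult_le_one)

lemma means_convex:
  assumes "m \<in> means \<Omega>" "m' \<in> means \<Omega>" "0 \<le> s" "s \<le> (1::real)"
  shows "(\<lambda>f. (1 - s) * m f + s * m' f) \<in> means \<Omega>"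
  unfolding means_def
proof (intro CollectI conjI allI impI)
  fix f
  have m: "0 \<le> m f" "m f \<le> 1" and m': "0 \<le> m' f" "m' f \<le> 1"
    using assms by (auto simp: means_def)
  then show "0 \<le> (1 - s) * m f + s * m' f"
    using assms by simp
  have "(1 - s) * m f + s * m' f \<le> (1 - s) * 1 + s * 1"
    using assms m m' by (intro add_mono mult_left_mono) auto
  then show "(1 - s) * m f + s * m' f \<le> 1" by simp
qed (use assms in \<open>simp_all add: means_def algebra_simps\<close>)

text \<open>Tychonoff's theorem: all defining conditions are closed for pointwise convergence.\<close>

lemma compact_means: "compact (means \<Omega>)"
proof -
  have "compactin (product_topology (\<lambda>_. euclidean) UNIV) (PiE UNIV (\<lambda>_::'a \<Rightarrow> real. {0..1::real}))"
    by (subst compactin_PiE) auto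
  then have box: "compact (PiE UNIV (\<lambda>_::'a \<Rightarrow> real. {0..1::real}))"
    by (simp add: euclidean_product_topology)
  have ev: "continuous_on UNIV (\<lambda>m::('a \<Rightarrow> real) \<Rightarrow> real. m f)" for f
    by (rule continuous_on_product_coordinates)
  have "closed (means \<Omega>)"
    unfolding means_def Collect_conj_eq Collect_all_eq Collect_imp_eq
    by (intro closed_Int closed_INT ballI closed_Un closed_Collect_le closed_Collect_eq
        continuous_intros ev) (auto intro: closed_Collect_const)
  then have "compact (PiE UNIV (\<lambda>_::'a \<Rightarrow> real. {0..1::real}) \<inter> means \<Omega>)"
    using box by (rule compact_Int_closed[rotated])
  moreover have "PiE UNIV (\<lambda>_::'a \<Rightarrow> real. {0..1::real}) \<inter> means \<Omega> = means \<Omega>"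
    by (auto simp: means_def PiE_def)
  ultimately show ?thesis by simp
qed

text \<open>The finite-dimensional core of the minimax argument. If the minimal total squared defect \<open>D m\<close> were
  positive, let \<open>t\<close> be the vector of defects of \<open>m\<close>. The hypothesis supplies a point \<open>x\<close> whose vector
  of surpluses \<open>f i x - c i\<close> has a nonnegative inner product with \<open>t\<close>. Moving
  from \<open>m\<close> to the evaluation at \<open>x\<close> by a proportion \<open>s\<close> changes \<open>D\<close> to at most
  \<open>(1 - s)\<^sup>2 D m + s\<^sup>2 B\<close>, where \<open>B\<close> is the squared length
  of the vector of surpluses; this is less than \<open>D m\<close> for small \<open>s\<close>.\<close>

lemma finite_mean_domination:
  fixes f :: "'i \<Rightarrow> 'a \<Rightarrow> real" and c :: "'i \<Rightarrow> real"
  assumes I: "finite I" and f: "\<And>i. i \<in> I \<Longrightarrow> unit_valued_on \<Omega> (f i)" and ne: "\<Omega> \<noteq> {}"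
    and pointwise: "\<And>t. (\<And>i. 0 \<le> t i) \<Longrightarrow> \<exists>x\<in>\<Omega>. (\<Sum>i\<in>I. t i * c i) \<le> (\<Sum>i\<in>I. t i * f i x)"
  shows "\<exists>m\<in>means \<Omega>. \<forall>i\<in>I. c i \<le> m (f i)"
proof -
  define D where "D = (\<lambda>m. \<Sum>i\<in>I. (max 0 (c i - m (f i)))\<^sup>2)"
  have "continuous_on (means \<Omega>) D"
    unfolding D_def
    by (intro continuous_intros continuous_on_subset[OF continuous_on_product_coordinates]) auto
  moreover have "means \<Omega> \<noteq> {}"
    using ne point_mean by fastforce
  ultimately obtain m where m: "m \<in> means \<Omega>" and min: "\<And>m'. m' \<in> means \<Omega> \<Longrightarrow> D m \<le> D m'"
    using continuous_attains_inf[OF compact_means] by metis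
  define t where "t = (\<lambda>i. max 0 (c i - m (f i)))"
  have D: "D m = (\<Sum>i\<in>I. (t i)\<^sup>2)" by (simp add: D_def t_def)
  have "D m = 0"
  proof (rule ccontr)
    assume "D m \<noteq> 0"
    then have pos: "0 < D m" using sum_nonneg[of I "\<lambda>i. (t i)\<^sup>2"] by (simp add: D)
    obtain x where x: "x \<in> \<Omega>" and le: "(\<Sum>i\<in>I. t i * c i) \<le> (\<Sum>i\<in>I. t i * f i x)"
      using pointwise[of t] by (auto simp: t_def)
    define B where "B = (\<Sum>i\<in>I. (c i - f i x)\<^sup>2)"
    have B: "0 \<le> B" by (simp add: B_def sum_nonneg)
    \<comment> \<open>The value of \<open>s\<close> that minimises \<open>(1 - s)\<^sup>2 * D m + s\<^sup>2 * B\<close>.\<close>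
    define s where "s = D m / (D m + B)"
    have s: "0 < s" "s \<le> 1" "s * (D m + B) = D m"
      using pos B by (auto simp: s_def)
    define m' where "m' = (\<lambda>g. (1 - s) * m g + s * (if unit_valued_on \<Omega> g then g x else 0))"
    have "m' \<in> means \<Omega>"
      unfolding m'_def using s x by (intro means_convex m point_mean) auto
    then have "D m \<le> D m'" by (rule min)
    also have "\<dots> \<le> (\<Sum>i\<in>I. ((1 - s) * t i + s * (c i - f i x))\<^sup>2)"
      unfolding D_def
    proof (rule sum_mono)
      fix i assume i: "i \<in> I"
      have "c i - m' (f i) = (1 - s) * (c i - m (f i)) + s * (c i - f i x)"
        using f[OF i] by (simp add: m'_def algebra_simps)
      also have "\<dots> \<le> (1 - s) * t i + s * (c i - f i x)"
        using s by (intro add_right_mono mult_left_mono) (auto simp: t_def)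
      finally show "(max 0 (c i - m' (f i)))\<^sup>2 \<le> ((1 - s) * t i + s * (c i - f i x))\<^sup>2"
        \<comment> \<open>The square of the positive part of a number is at most the square of any upper bound of it.\<close>
        by (cases "c i - m' (f i) \<le> 0") (auto intro: power_mono simp: max_def)
    qed
    also have "\<dots> = (\<Sum>i\<in>I. (1 - s)\<^sup>2 * (t i)\<^sup>2 + 2 * s * (1 - s) * (t i * c i - t i * f i x)
        + s\<^sup>2 * (c i - f i x)\<^sup>2)"
      by (intro sum.cong) (auto simp: power2_eq_square algebra_simps)
    also have "\<dots> = (1 - s)\<^sup>2 * D m + 2 * s * (1 - s) * ((\<Sum>i\<in>I. t i * c i) - (\<Sum>i\<in>I. t i * f i x))
        + s\<^sup>2 * B"
      by (simp only: sum.distrib D B_def sum_distrib_left[symmetric] sum_subtractf)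
    also have "\<dots> \<le> (1 - s)\<^sup>2 * D m + s\<^sup>2 * B"
      using le s by (simp add: mult_nonneg_nonpos)
    also have "\<dots> = D m - 2 * s * D m + s * (s * (D m + B))"
      by (simp add: power2_eq_square algebra_simps)
    also have "\<dots> = D m - s * D m"
      using s by simp
    finally show False using s pos by (simp add: mult_le_0_iff)
  qed
  then have "\<forall>i\<in>I. t i = 0"
    using I by (simp add: D sum_nonneg_eq_0_iff)
  then have "\<forall>i\<in>I. c i \<le> m (f i)"
    by (auto simp: t_def max_def split: if_splits)
  then show ?thesis using m by blast
qed

text \<open>Each inequality cuts a closed subset out of the compact set of means, and
  \<open>finite_mean_domination\<close> is the finite intersection property of these subsets.\<close>

lemma mean_domination:
  fixes f :: "'i \<Rightarrow> 'a \<Rightarrow> real" and c :: "'i \<Rightarrow> real"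
  assumes f: "\<And>i. i \<in> I \<Longrightarrow> unit_valued_on \<Omega> (f i)" and ne: "\<Omega> \<noteq> {}"
    and pointwise: "\<And>J t. \<lbrakk>finite J; J \<subseteq> I; \<And>i. 0 \<le> t i\<rbrakk>
      \<Longrightarrow> \<exists>x\<in>\<Omega>. (\<Sum>i\<in>J. t i * c i) \<le> (\<Sum>i\<in>J. t i * f i x)"
  shows "\<exists>m\<in>means \<Omega>. \<forall>i\<in>I. c i \<le> m (f i)"
proof -
  have "means \<Omega> \<inter> (\<Inter>i\<in>I. {m. c i \<le> m (f i)}) \<noteq> {}"
  proof (rule compact_imp_fip_image[OF compact_means])
    show "closed {m. c i \<le> m (f i)}" if "i \<in> I" for i
      by (intro closed_Collect_le continuous_intros continuous_on_product_coordinates)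
    show "means \<Omega> \<inter> (\<Inter>i\<in>J. {m. c i \<le> m (f i)}) \<noteq> {}" if "finite J" "J \<subseteq> I" for J
      using finite_mean_domination[of J \<Omega> f c] that f ne pointwise by fastforce
  qed
  then show ?thesis by blast
qed

lemma mean_sum:
  assumes m: "m \<in> means \<Omega>" and "finite J"
    and "\<And>j. j \<in> J \<Longrightarrow> unit_valued_on \<Omega> (f j)" "unit_valued_on \<Omega> (\<lambda>x. \<Sum>j\<in>J. f j x)"
  shows "m (\<lambda>x. \<Sum>j\<in>J. f j x) = (\<Sum>j\<in>J. m (f j))"
  using assms(2-)
proof (induction J rule: finite_induct)
  case empty
  have "m (\<lambda>x. 0 * 1) = 0 * m (\<lambda>_. 1)"
    by (rule mean_scale[OF m]) (auto simp: unit_valued_on_def)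
  then show ?case by simp
next
  case (insert j J)
  have 0: "0 \<le> (\<Sum>i\<in>J. f i x)" if "x \<in> \<Omega>" for x
    using insert.prems(1) that by (intro sum_nonneg) (auto simp: unit_valued_on_def)
  have u: "unit_valued_on \<Omega> (\<lambda>x. f j x + (\<Sum>i\<in>J. f i x))"
    using insert by simp
  then have uJ: "unit_valued_on \<Omega> (\<lambda>x. \<Sum>i\<in>J. f i x)"
    using 0 insert.prems(1)[of j] by (force simp: unit_valued_on_def)
  show ?case
    using mean_add[OF m insert.prems(1)[of j] uJ u] insert uJ by simp
qed

section \<open>From means to regular Borel measures\<close>

lemma borel_measurable_continuous_map:
  fixes f :: "'a \<Rightarrow> 'b::topological_space"
  assumes \<mu>: "regular_borel_prob X \<mu>" and f: "continuous_map X euclidean f"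
  shows "f \<in> borel_measurable \<mu>"
proof (rule borel_measurableI)
  fix S :: "'b set" assume "open S"
  then have "openin X {x \<in> topspace X. f x \<in> S}"
    using f by (auto simp: continuous_map_def)
  moreover have "f -` S \<inter> space \<mu> = {x \<in> topspace X. f x \<in> S}"
    using \<mu> by (auto simp: regular_borel_prob_def)
  ultimately show "f -` S \<inter> space \<mu> \<in> sets \<mu>"
    using \<mu> by (auto simp: regular_borel_prob_def intro: sigma_sets.Basic)
qed

lemma integrable_continuous_map:
  fixes f :: "'a \<Rightarrow> real"
  assumes \<mu>: "regular_borel_prob X \<mu>" and X: "compact_space X" and f: "continuous_map X euclidean f"
  shows "integrable \<mu> f"
proof -
  interpret prob_space \<mu> using \<mu> by (simp add: regular_borel_prob_def)
  have "compact (f ` topspace X)"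
    using image_compactin[OF _ f] X by (simp add: compact_space_def)
  then obtain B where "\<And>x. x \<in> topspace X \<Longrightarrow> norm (f x) \<le> B"
    using compact_imp_bounded by (metis bounded_iff imageI)
  moreover have "space \<mu> = topspace X" using \<mu> by (simp add: regular_borel_prob_def)
  ultimately show ?thesis
    by (intro integrable_const_bound[where B = B] AE_I2 borel_measurable_continuous_map[OF \<mu> f]) auto
qed

text \<open>The levels \<open>k/n\<close> start at \<open>k = 0\<close> and stop before \<open>k = n\<close>. With this choice \<open>s\<close> approximates \<open>y\<close> from
  above and still does not exceed \<open>1\<close>, so that a mean can be applied to it.\<close>

lemma layer_sum_bounds:
  fixes y :: real
  assumes y: "0 \<le> y" "y \<le> 1" and n: "0 < n"
  defines "s \<equiv> (\<Sum>k<n. 1 / real n * of_bool (real k / real n \<le> y))"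
  shows "y \<le> s" "s \<le> 1" "s \<le> y + 1 / real n"
proof -
  define j where "j = nat \<lfloor>real n * y\<rfloor>"
  have "real k / real n \<le> y \<longleftrightarrow> k \<le> j" for k
    using n y by (simp add: j_def le_nat_iff le_floor_iff field_simps)
  then have "s = (\<Sum>k<n. 1 / real n * of_bool (k \<le> j))" by (simp add: s_def)
  also have "\<dots> = (1 / real n) * (\<Sum>k<n. of_bool (k \<le> j))" by (simp only: sum_distrib_left)
  also have "(\<Sum>k<n. of_bool (k \<le> j)) = real (card ({..<n} \<inter> {k. k \<le> j}))"
    by (simp add: sum_of_bool_eq)
  also have "{..<n} \<inter> {k. k \<le> j} = {..<min n (Suc j)}" by auto
  finally have s: "s = real (min n (Suc j)) / real n" by simp
  have j: "real j \<le> real n * y" "real n * y < real j + 1"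
    using y by (simp_all add: j_def)
  show "s \<le> 1" using n by (simp add: s)
  show "y \<le> s"
  proof (cases "n \<le> Suc j")
    case True then show ?thesis using y n by (simp add: s)
  next
    case False then show ?thesis using j n by (simp add: s field_simps)
  qed
  have "real (min n (Suc j)) \<le> real n * y + 1" using j by linarith
  then show "s \<le> y + 1 / real n" using n by (simp add: s field_simps)
qed

lemma mean_content:
  assumes X: "compact_space X" "Hausdorff_space X" and m: "m \<in> means (topspace X)"
  shows "compact_content X (\<lambda>K. ennreal (m (indicator K)))"
proof
  note unit = unit_valued_on_def
  have ind: "unit_valued_on (topspace X) (indicator K)" for K
    by (auto simp: unit indicator_def)
  have Un: "m (indicator (K \<union> L)) = m (indicator K) + m (indicator L)" if "K \<inter> L = {}" for K L
  proof -
    have "indicator (K \<union> L) = (\<lambda>x. indicator K x + indicator L x :: real)"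
      using that by (auto simp: indicator_def fun_eq_iff)
    with mean_add[OF m ind ind, of K L] ind[of "K \<union> L"] show ?thesis by simp
  qed
  have mono: "m (indicator K) \<le> m (indicator L)" if "K \<subseteq> L" for K L
    using that by (intro mean_mono[OF m ind ind]) (auto simp: indicator_def)
  show "ennreal (m (indicator {})) = 0"
    using Un[of "{}" "{}"] by simp
  show "ennreal (m (indicator K)) \<le> ennreal (m (indicator L))" if "K \<subseteq> L" for K L
    using mono[OF that] by (rule ennreal_leI)
  show "ennreal (m (indicator (K \<union> L))) \<le> ennreal (m (indicator K)) + ennreal (m (indicator L))" for K L
    using Un[of K "L - K"] mono[of "L - K" L]
    by (simp add: mean_nonneg[OF m] flip: ennreal_plus)
  show "ennreal (m (indicator (K \<union> L))) = ennreal (m (indicator K)) + ennreal (m (indicator L))"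
    if "K \<inter> L = {}" for K L
    using Un[OF that] by (simp add: mean_nonneg[OF m] flip: ennreal_plus)
  have "m (indicator (topspace X)) = m (\<lambda>_. 1)"
    by (intro antisym mean_mono[OF m ind] mean_mono[OF m _ ind]) (auto simp: unit)
  then show "ennreal (m (indicator (topspace X))) = 1"
    using mean_one[OF m] by simp
qed (fact X)+

text \<open>Up to \<open>1/n\<close> a continuous function is the average of the indicators of its superlevel sets. These sets
  are closed, so the measure obtained from the content dominates the mean on each of them.\<close>

lemma mean_le_integral:
  assumes X: "compact_space X" "Hausdorff_space X" and m: "m \<in> means (topspace X)"
  shows "\<exists>\<mu>. regular_borel_prob X \<mu> \<and>
    (\<forall>f. continuous_map X euclidean f \<longrightarrow> unit_valued_on (topspace X) f \<longrightarrow> m f \<le> (LINT x|\<mu>. f x))"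
proof -
  interpret compact_content X "\<lambda>K. ennreal (m (indicator K))"
    by (rule mean_content[OF assms])
  let ?\<mu> = content_measure
  note reg = regular_content_measure
  interpret prob_space ?\<mu> using reg by (simp add: regular_borel_prob_def)
  have "m f \<le> (LINT x|?\<mu>. f x)"
    if f: "continuous_map X euclidean f" and f01: "unit_valued_on (topspace X) f" for f
  proof (rule field_le_epsilon)
    fix e :: real assume "0 < e"
    then obtain n where n: "0 < n" "1 / real n < e"
      using nat_approx_posE by (metis zero_less_Suc)
    define K where "K = (\<lambda>k::nat. {x \<in> topspace X. real k / real n \<le> f x})"
    define s where "s = (\<lambda>x. \<Sum>k<n. 1 / real n * indicator (K k) x)"
    have K: "closedin X (K k)" for k
      using closedin_continuous_map_preimage[OF f, of "{real k / real n..}"] by (simp add: K_def)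
    have int: "integrable ?\<mu> (indicator (K k) :: 'a \<Rightarrow> real)" for k
      by (rule integrable_real_indicator) (use K in \<open>auto simp: closedin_sets emeasure_eq_measure\<close>)
    have s_eq: "s x = (\<Sum>k<n. 1 / real n * of_bool (real k / real n \<le> f x))" if "x \<in> topspace X" for x
      using that by (simp add: s_def K_def indicator_def)
    have s: "f x \<le> s x" "s x \<le> 1" "s x \<le> f x + 1 / real n" "0 \<le> f x" if "x \<in> topspace X" for x
      using layer_sum_bounds[of "f x" n] f01 n that by (auto simp: s_eq unit_valued_on_def)
    have s01: "unit_valued_on (topspace X) s"
      using s by (force simp: unit_valued_on_def)
    have "m f \<le> m s"
      by (intro mean_mono[OF m f01 s01] s)
    also have "\<dots> = (\<Sum>k<n. m (\<lambda>x. 1 / real n * indicator (K k) x))"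
      unfolding s_def using s01 n
      by (intro mean_sum[OF m]) (auto simp: s_def unit_valued_on_def indicator_def)
    also have "\<dots> = (\<Sum>k<n. 1 / real n * m (indicator (K k)))"
      using n by (intro sum.cong refl mean_scale[OF m]) (auto simp: unit_valued_on_def indicator_def)
    also have "\<dots> \<le> (\<Sum>k<n. 1 / real n * prob (K k))"
      using content_le_measure[OF K]
      by (intro sum_mono mult_left_mono) (auto simp: emeasure_eq_measure)
    also have "\<dots> = (LINT x|?\<mu>. s x)"
      unfolding s_def using int
      by (subst Bochner_Integration.integral_sum) (auto simp: closedin_sets K)
    also have "\<dots> \<le> (LINT x|?\<mu>. f x + 1 / real n)"
    proof (rule integral_mono)
      show "integrable ?\<mu> s" using int by (auto simp: s_def)
      show "integrable ?\<mu> (\<lambda>x. f x + 1 / real n)"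
        using integrable_continuous_map[OF reg X(1) f] by simp
    qed (use s in \<open>simp add: space_content_measure\<close>)
    also have "\<dots> = (LINT x|?\<mu>. f x) + 1 / real n"
      using integrable_continuous_map[OF reg X(1) f] by (simp add: prob_space)
    finally show "m f \<le> (LINT x|?\<mu>. f x) + e" using n by simp
  qed
  then show ?thesis using reg by blast
qed

text \<open>The minimax principle behind Pietsch domination. In the hypothesis the point may depend on the
  combination of inequalities; averaging over points removes this dependence.\<close>

theorem regular_measure_domination:
  fixes f :: "'i \<Rightarrow> 'a \<Rightarrow> real" and c :: "'i \<Rightarrow> real"
  assumes X: "compact_space X" "Hausdorff_space X" "topspace X \<noteq> {}"
    and f: "\<And>i. i \<in> I \<Longrightarrow> continuous_map X euclidean (f i)"
    and pointwise: "\<And>J t. \<lbrakk>finite J; J \<subseteq> I; \<And>i. 0 \<le> t i\<rbrakk>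
      \<Longrightarrow> \<exists>x\<in>topspace X. (\<Sum>i\<in>J. t i * c i) \<le> (\<Sum>i\<in>J. t i * f i x)"
  shows "\<exists>\<mu>. regular_borel_prob X \<mu> \<and> (\<forall>i\<in>I. c i \<le> (LINT x|\<mu>. f i x))"
proof -
  have "\<exists>B>0. \<forall>x\<in>topspace X. \<bar>f i x\<bar> \<le> B" if "i \<in> I" for i
  proof -
    have "compact (f i ` topspace X)"
      using image_compactin[OF _ f[OF that]] X by (simp add: compact_space_def)
    then show ?thesis
      using compact_imp_bounded by (fastforce simp: bounded_pos)
  qed
  then obtain B where B: "\<And>i. i \<in> I \<Longrightarrow> 0 < B i"
      "\<And>i x. i \<in> I \<Longrightarrow> x \<in> topspace X \<Longrightarrow> \<bar>f i x\<bar> \<le> B i"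
    by metis
  \<comment> \<open>An affine rescaling moves each function into the unit interval and preserves the inequalities.\<close>
  define f' where "f' = (\<lambda>i x. (f i x + B i) / (2 * B i))"
  define c' where "c' = (\<lambda>i. (c i + B i) / (2 * B i))"
  have f'01: "unit_valued_on (topspace X) (f' i)" if "i \<in> I" for i
    unfolding unit_valued_on_def
  proof
    fix x assume "x \<in> topspace X"
    from B(2)[OF that this] B(1)[OF that] show "0 \<le> f' i x \<and> f' i x \<le> 1"
      by (auto simp: f'_def field_simps abs_le_iff)
  qed
  have "\<exists>m\<in>means (topspace X). \<forall>i\<in>I. c' i \<le> m (f' i)"
  proof (rule mean_domination[OF f'01 X(3)])
    fix J and t :: "'i \<Rightarrow> real" assume J: "finite J" "J \<subseteq> I" and t: "\<And>i. 0 \<le> t i"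
    define r where "r = (\<lambda>i. if i \<in> I then t i / (2 * B i) else 0)"
    have "0 \<le> r i" for i using B(1)[of i] t[of i] by (auto simp: r_def intro: divide_nonneg_pos)
    then obtain x where x: "x \<in> topspace X" "(\<Sum>i\<in>J. r i * c i) \<le> (\<Sum>i\<in>J. r i * f i x)"
      using pointwise[OF J] by blast
    have "(\<Sum>i\<in>J. t i * c' i) = (\<Sum>i\<in>J. r i * c i) + (\<Sum>i\<in>J. r i * B i)"
      unfolding sum.distrib[symmetric] using J
      by (intro sum.cong) (auto simp: r_def c'_def add_divide_distrib algebra_simps)
    also have "\<dots> \<le> (\<Sum>i\<in>J. r i * f i x) + (\<Sum>i\<in>J. r i * B i)"
      using x by simp
    also have "\<dots> = (\<Sum>i\<in>J. t i * f' i x)"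
      unfolding sum.distrib[symmetric] using J
      by (intro sum.cong) (auto simp: r_def f'_def add_divide_distrib algebra_simps)
    finally show "\<exists>x\<in>topspace X. (\<Sum>i\<in>J. t i * c' i) \<le> (\<Sum>i\<in>J. t i * f' i x)"
      using x by blast
  qed
  then obtain m where m: "m \<in> means (topspace X)" "\<And>i. i \<in> I \<Longrightarrow> c' i \<le> m (f' i)" by blast
  obtain \<mu> where \<mu>: "regular_borel_prob X \<mu>"
    and le: "\<And>g. continuous_map X euclidean g \<Longrightarrow> unit_valued_on (topspace X) g \<Longrightarrow> m g \<le> (LINT x|\<mu>. g x)"
    using mean_le_integral[OF X(1,2) m(1)] by blast
  interpret prob_space \<mu> using \<mu> by (simp add: regular_borel_prob_def)
  have "c i \<le> (LINT x|\<mu>. f i x)" if i: "i \<in> I" for i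
  proof -
    have "continuous_map X euclidean (f' i)"
      unfolding f'_def using B(1)[OF i]
      by (intro continuous_intros f i) auto
    then have "c' i \<le> (LINT x|\<mu>. f' i x)"
      using m(2)[OF i] le f'01[OF i] by force
    also have "\<dots> = ((LINT x|\<mu>. f i x) + B i) / (2 * B i)"
      using integrable_continuous_map[OF \<mu> X(1) f[OF i]] by (simp add: f'_def prob_space)
    finally show ?thesis
      using B(1)[OF i] by (simp add: c'_def divide_le_cancel)
  qed
  with \<mu> show ?thesis by blast
qed

section \<open>Weak* compactness of the dual ball\<close>

lemma continuous_map_weak_star_eval:
  "continuous_map weak_star_ball euclidean (\<lambda>g. blinfun_apply g (y::'b::complex_normed_vector))"
proof -
  have "continuous_map euclidean euclidean (\<lambda>h::'b \<Rightarrow> complex. h y)"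
    by (simp add: continuous_on_product_coordinates)
  from continuous_map_pullback[OF this, of cdual_ball blinfun_apply] show ?thesis
    by (simp add: weak_star_ball_def euclidean_product_topology o_def)
qed

lemma topspace_weak_star_ball: "topspace weak_star_ball = cdual_ball"
  by (simp add: weak_star_ball_def topspace_pullback_topology)

lemma Hausdorff_weak_star_ball: "Hausdorff_space (weak_star_ball :: ('b::complex_normed_vector \<Rightarrow>\<^sub>L complex) topology)"
proof (rule Hausdorff_space_injective_preimage)
  show "Hausdorff_space (euclidean :: ('b \<Rightarrow> complex) topology)"
    by (simp add: Hausdorff_space_product_topology flip: euclidean_product_topology)
  show "continuous_map weak_star_ball (euclidean :: ('b \<Rightarrow> complex) topology) blinfun_apply"
    using continuous_map_pullback[OF continuous_map_id, of cdual_ball blinfun_apply "euclidean :: ('b \<Rightarrow> complex) topology"]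
    by (simp add: weak_star_ball_def euclidean_product_topology o_def)
  show "inj_on blinfun_apply (topspace (weak_star_ball :: ('b \<Rightarrow>\<^sub>L complex) topology))"
    by (simp add: inj_on_def blinfun_apply_inject)
qed

text \<open>The Banach--Alaoglu theorem. As a set of functions, the dual ball consists of the complex-linear
  maps inside the product of the discs of radius \<open>norm y\<close>; linearity is a closed condition for
  pointwise convergence.\<close>

lemma compact_weak_star_ball: "compact_space (weak_star_ball :: ('b::complex_normed_vector \<Rightarrow>\<^sub>L complex) topology)"
proof -
  define L where "L = {h::'b \<Rightarrow> complex. clinear_on UNIV h \<and> (\<forall>y. cmod (h y) \<le> norm y)}"
  have ev: "continuous_on UNIV (\<lambda>h::'b \<Rightarrow> complex. h y)" for y
    by (rule continuous_on_product_coordinates)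
  have "closed L"
    unfolding L_def clinear_on_def scaleC_complex_def Collect_conj_eq Collect_all_eq ball_UNIV
    by (intro closed_Int closed_INT ballI closed_Collect_le closed_Collect_eq continuous_intros ev)
  moreover have "compact (PiE UNIV (\<lambda>y::'b. cball (0::complex) (norm y)))"
  proof -
    have "compactin (product_topology (\<lambda>_. euclidean) UNIV) (PiE UNIV (\<lambda>y::'b. cball (0::complex) (norm y)))"
      by (subst compactin_PiE) auto
    then show ?thesis by (simp add: euclidean_product_topology)
  qed
  ultimately have "compact (PiE UNIV (\<lambda>y::'b. cball (0::complex) (norm y)) \<inter> L)"
    by (rule compact_Int_closed[rotated])
  moreover have "PiE UNIV (\<lambda>y::'b. cball (0::complex) (norm y)) \<inter> L = L"
    by (auto simp: L_def)
  ultimately have L: "compact L" by simp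
  have bl: "bounded_linear h" if "h \<in> L" for h
  proof (rule bounded_linear_intro[where K = 1])
    fix r x
    have "h (complex_of_real r *\<^sub>C x) = complex_of_real r * h x"
      using that by (simp add: L_def clinear_on_def scaleC_complex_def)
    then show "h (r *\<^sub>R x) = r *\<^sub>R h x" by (simp add: scaleR_scaleC scaleC_complex_def)
  qed (use that in \<open>auto simp: L_def clinear_on_def\<close>)
  have Blinfun_in: "Blinfun h \<in> cdual_ball" if "h \<in> L" for h
    using that norm_blinfun_bound[of 1 "Blinfun h"]
    by (auto simp: cdual_ball_def cdual_def bounded_linear_Blinfun_apply[OF bl] L_def)
  have "continuous_map (top_of_set L) weak_star_ball Blinfun"
    unfolding weak_star_ball_def euclidean_product_topology
  proof (rule continuous_map_pullback')
    show "continuous_map (top_of_set L) euclidean (blinfun_apply \<circ> Blinfun)"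
      by (rule continuous_map_eq[where f = id])
        (auto simp: bounded_linear_Blinfun_apply[OF bl] intro: continuous_on_id)
    show "topspace (top_of_set L) \<subseteq> Blinfun -` cdual_ball"
      using Blinfun_in by auto
  qed
  moreover have "compactin (top_of_set L) L"
    using L by (simp add: compactin_subtopology)
  ultimately have "compactin weak_star_ball (Blinfun ` L)"
    by (rule image_compactin[rotated])
  moreover have "Blinfun ` L = cdual_ball"
  proof
    show "cdual_ball \<subseteq> Blinfun ` L"
    proof
      fix g :: "'b \<Rightarrow>\<^sub>L complex" assume g: "g \<in> cdual_ball"
      have "cmod (blinfun_apply g y) \<le> norm y" for y
        using norm_blinfun[of g y] g mult_right_mono[of "norm g" 1 "norm y"] by (simp add: cdual_ball_def)
      then have "blinfun_apply g \<in> L"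
        using g by (simp add: L_def cdual_ball_def cdual_def)
      then show "g \<in> Blinfun ` L" by (metis blinfun_apply_inverse imageI)
    qed
  qed (use Blinfun_in in auto)
  ultimately show ?thesis
    by (simp add: compact_space_def topspace_weak_star_ball)
qed

section \<open>Hoelder's inequality and conjugate indices\<close>

lemma sum_Holder:
  fixes a b :: "'i \<Rightarrow> real"
  assumes I: "finite I" and ab: "\<And>i. i \<in> I \<Longrightarrow> 0 \<le> a i" "\<And>i. i \<in> I \<Longrightarrow> 0 \<le> b i"
    and pq: "1 < p" "1 < q" "1 / p + 1 / q = 1"
  shows "(\<Sum>i\<in>I. a i * b i) \<le> (\<Sum>i\<in>I. a i powr p) powr (1 / p) * (\<Sum>i\<in>I. b i powr q) powr (1 / q)"
proof -
  define A where "A = (\<Sum>i\<in>I. a i powr p) powr (1 / p)"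
  define B where "B = (\<Sum>i\<in>I. b i powr q) powr (1 / q)"
  have AB: "0 \<le> A" "0 \<le> B" by (simp_all add: A_def B_def)
  have A: "A powr p = (\<Sum>i\<in>I. a i powr p)" and B: "B powr q = (\<Sum>i\<in>I. b i powr q)"
    using pq by (simp_all add: A_def B_def powr_powr sum_nonneg)
  show ?thesis
  proof (cases "A = 0 \<or> B = 0")
    case True
    have "A = 0 \<Longrightarrow> \<forall>i\<in>I. a i = 0" "B = 0 \<Longrightarrow> \<forall>i\<in>I. b i = 0"
      using A B I by (auto simp: sum_nonneg_eq_0_iff)
    then have "(\<Sum>i\<in>I. a i * b i) = 0" using True by (intro sum.neutral) auto
    then show ?thesis by simp
  next
    case False
    with AB have pos: "0 < A" "0 < B" by auto
    \<comment> \<open>Young's inequality for the sequences scaled to have norm one.\<close>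
    have "(\<Sum>i\<in>I. (a i / A) * (b i / B)) \<le> (\<Sum>i\<in>I. (a i / A) powr p / p + (b i / B) powr q / q)"
      using pos ab pq by (intro sum_mono Youngs_inequality) auto
    also have "\<dots> = (\<Sum>i\<in>I. a i powr p) / A powr p / p + (\<Sum>i\<in>I. b i powr q) / B powr q / q"
      using pos ab by (simp add: sum.distrib powr_divide sum_divide_distrib)
    also have "\<dots> = 1" using pos pq by (simp flip: A B)
    finally have "(\<Sum>i\<in>I. a i * b i) / (A * B) \<le> 1"
      by (simp add: sum_divide_distrib)
    then show ?thesis using pos by (simp add: A_def[symmetric] B_def[symmetric])
  qed
qed

lemma conj_index_cases:
  assumes "1 < p"
  obtains "p = \<top>" "enn2real (conj_index p) = 1"
  | r where "1 < r" "p = ennreal r" "1 < enn2real (conj_index p)" "1 / r + 1 / enn2real (conj_index p) = 1"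
proof (cases p rule: ennreal_cases)
  case (real r)
  then have r: "1 < r" using assms by (metis ennreal_1 ennreal_less_iff zero_le_one)
  then have "enn2real (conj_index p) = r / (r - 1)" using real by (simp add: conj_index_ennreal)
  moreover have "1 < r / (r - 1)" "1 / r + 1 / (r / (r - 1)) = 1" using r by (auto simp: field_simps)
  ultimately show ?thesis using that(2) r real by simp
qed (use that(1) in \<open>simp add: conj_index_top\<close>)

lemma conj_index_ge_1: "1 < p \<Longrightarrow> 1 \<le> enn2real (conj_index p)"
  by (cases rule: conj_index_cases) auto

lemma conj_index_neq_top: "1 < p \<Longrightarrow> conj_index p \<noteq> \<top>"
  using conj_index_ge_1[of p] by fastforce

lemma lp_norm_Holder:
  assumes p: "1 < p" and b: "\<And>i. i < n \<Longrightarrow> 0 \<le> b i"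
  defines "q \<equiv> enn2real (conj_index p)"
  shows "(\<Sum>i<n. cmod (l i) * b i) \<le> lp_norm p n l * (\<Sum>i<n. b i powr q) powr (1 / q)"
  using p
proof (cases rule: conj_index_cases)
  case 1
  have "(\<Sum>i<n. cmod (l i) * b i) \<le> (\<Sum>i<n. lp_norm p n l * b i)"
    using b by (intro sum_mono mult_right_mono) (auto simp: lp_norm_def 1)
  also have "\<dots> = lp_norm p n l * (\<Sum>i<n. b i)" by (simp add: sum_distrib_left)
  moreover have "(\<Sum>i<n. b i powr 1) = (\<Sum>i<n. b i)" "0 \<le> (\<Sum>i<n. b i)"
    using b by (auto intro: sum.cong sum_nonneg)
  ultimately show ?thesis using 1 unfolding q_def by (simp only: powr_one div_by_1)
next
  case (2 r)
  then show ?thesis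
    using sum_Holder[of "{..<n}" "\<lambda>i. cmod (l i)" b r q] b by (simp add: lp_norm_def q_def)
qed

text \<open>For nonnegative \<open>a\<close> these are the weights for which Hoelder's inequality is an equality: paired
  with \<open>a\<close> they give \<open>\<Sum> a\<^sub>i\<^sup>q\<close>.\<close>

lemma lp_norm_dual_weights:
  fixes a :: "nat \<Rightarrow> real"
  assumes p: "1 < p"
  defines "q \<equiv> enn2real (conj_index p)"
  shows "lp_norm p n (\<lambda>i. complex_of_real (a i powr (q - 1))) \<le> (\<Sum>i<n. a i powr q) powr (1 - 1 / q)"
  using p
proof (cases rule: conj_index_cases)
  case 1
  show ?thesis
  proof (cases "\<forall>i<n. a i = 0")
    case True
    then show ?thesis using 1 by (auto simp: lp_norm_def q_def intro!: Max.boundedI)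
  next
    case False
    then obtain i where "i < n" "a i \<noteq> 0" by blast
    then have "0 < (\<Sum>i<n. a i powr q)"
      by (intro sum_pos2[of _ i]) auto
    then have "(\<Sum>i<n. a i powr q) powr (1 - 1 / q) = 1"
      using 1 by (simp add: q_def)
    then show ?thesis
      using 1 by (simp only:) (auto simp: lp_norm_def q_def powr_def intro!: Max.boundedI)
  qed
next
  case (2 r)
  then have q: "1 < q" "1 / r = 1 - 1 / q" "(q - 1) * r = q"
    by (auto simp: q_def field_simps)
  have "(a i powr (q - 1)) powr r = a i powr q" for i
    using q by (simp add: powr_powr)
  then show ?thesis using 2 q by (simp add: lp_norm_def)
qed

section \<open>Linear functionals on the tensor space\<close>

lemma delta_tensor_scaleR: "delta_tensor U x (r *\<^sub>R y) = complex_of_real r *\<^sub>C delta_tensor U x y"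
  by (auto simp: delta_tensor_def scaleC_fun_def scaleC_complex_def fun_eq_iff blinfun.scaleR_right scaleR_conv_of_real)

lemma delta_tensor_mem: "x \<in> U \<Longrightarrow> delta_tensor U x y \<in> Delta_tensor U"
  unfolding Delta_tensor_def by (rule complex_vector.span_base) auto

lemma tensor_sum_mem: "(\<And>i. i < n \<Longrightarrow> x i \<in> U) \<Longrightarrow> tensor_sum U n l x y \<in> Delta_tensor U"
  using delta_tensor_mem unfolding tensor_sum_def Delta_tensor_def
  by (intro complex_vector.span_sum complex_vector.span_scale) auto

lemma Delta_tensor_representation:
  assumes "u \<in> Delta_tensor U"
  shows "\<exists>n l x y. (\<forall>i<n. x i \<in> U) \<and> u = tensor_sum U n l x y"
  using assms unfolding Delta_tensor_def
proof (induction rule: complex_vector.span_induct_alt)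
  case base
  have "0 = tensor_sum U 0 (\<lambda>_. 0) (\<lambda>_. undefined) (\<lambda>_. 0)" by (simp add: tensor_sum_def)
  then show ?case by blast
next
  case (step c b u)
  then obtain n l x y z w where *: "\<forall>i<n. x i \<in> U" "u = tensor_sum U n l x y"
      "z \<in> U" "b = delta_tensor U z w"
    by auto
  have "c *\<^sub>C b + u = tensor_sum U (Suc n) (l(n := c)) (x(n := z)) (y(n := w))"
    using * by (simp add: tensor_sum_def add.commute)
  moreover have "\<forall>i<Suc n. (x(n := z)) i \<in> U" using * by (simp add: less_Suc_eq)
  ultimately show ?case by blast
qed

lemma functional_tensor_sum:
  assumes \<phi>: "clinear_on (Delta_tensor U) \<phi>" and x: "\<And>i. i < n \<Longrightarrow> x i \<in> U"
  shows "\<phi> (tensor_sum U n l x y) = (\<Sum>i<n. \<phi> (l i *\<^sub>C delta_tensor U (x i) (y i)))"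
  using x
proof (induction n)
  case 0
  have "\<phi> (0 *\<^sub>C 0) = 0 *\<^sub>C \<phi> 0"
    using \<phi> complex_vector.span_zero unfolding clinear_on_def Delta_tensor_def by blast
  then show ?case by (simp add: tensor_sum_def zero_fun_def)
next
  case (Suc n)
  have "tensor_sum U n l x y \<in> Delta_tensor U" "l n *\<^sub>C delta_tensor U (x n) (y n) \<in> Delta_tensor U"
    using Suc.prems tensor_sum_mem[of n x U l y] delta_tensor_mem[of "x n" U "y n"]
    by (auto simp: Delta_tensor_def complex_vector.span_scale)
  moreover have "tensor_sum U (Suc n) l x y = tensor_sum U n l x y + l n *\<^sub>C delta_tensor U (x n) (y n)"
    by (simp add: tensor_sum_def)
  ultimately have "\<phi> (tensor_sum U (Suc n) l x y)
      = \<phi> (tensor_sum U n l x y) + \<phi> (l n *\<^sub>C delta_tensor U (x n) (y n))"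
    using \<phi> by (simp only: clinear_on_def)
  then show ?case using Suc by simp
qed

lemma functional_scaleC:
  assumes "clinear_on (Delta_tensor U) \<phi>" "x \<in> U"
  shows "\<phi> (c *\<^sub>C delta_tensor U x y) = c * \<phi> (delta_tensor U x y)"
  using assms delta_tensor_mem[of x U y] by (simp add: clinear_on_def scaleC_complex_def)

definition abs_dominated ::
    "'a::complex_normed_vector set
       \<Rightarrow> ((('a \<Rightarrow> ('b::complex_normed_vector \<Rightarrow>\<^sub>L complex)) \<Rightarrow> complex) \<Rightarrow> complex)
       \<Rightarrow> real \<Rightarrow> ennreal \<Rightarrow> bool" where
  "abs_dominated U \<phi> C p \<longleftrightarrow> (\<forall>n l x y. (\<forall>i<n. x i \<in> U) \<longrightarrow>
     (\<Sum>i<n. cmod (\<phi> (l i *\<^sub>C delta_tensor U (x i) (y i)))) \<le> C * (lp_norm p n l * weak_lp_norm (conj_index p) n y))"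

text \<open>From left to right, unimodular factors \<open>e\<^sub>i\<close> on the scalars align the phases of all the terms
  of \<open>\<phi>(u)\<close>. They change the functional \<open>u\<close> but neither the \<open>\<ell>\<^sub>p\<close> norm of the scalars nor the vectors.\<close>

lemma chevet_saphar_bound_iff:
  fixes \<phi> :: "(('a::complex_normed_vector \<Rightarrow> ('b::complex_normed_vector \<Rightarrow>\<^sub>L complex)) \<Rightarrow> complex) \<Rightarrow> complex"
  assumes \<phi>: "clinear_on (Delta_tensor U) \<phi>" and C: "0 < C"
  shows "(\<forall>u\<in>Delta_tensor U. cmod (\<phi> u) \<le> C * chevet_saphar p U u) \<longleftrightarrow> abs_dominated U \<phi> C p"
proof
  assume bound: "\<forall>u\<in>Delta_tensor U. cmod (\<phi> u) \<le> C * chevet_saphar p U u"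
  show "abs_dominated U \<phi> C p"
    unfolding abs_dominated_def
  proof (intro allI impI)
    fix n l and x :: "nat \<Rightarrow> 'a" and y :: "nat \<Rightarrow> 'b" assume x: "\<forall>i<n. x i \<in> U"
    define v where "v = (\<lambda>i. \<phi> (l i *\<^sub>C delta_tensor U (x i) (y i)))"
    define e where "e = (\<lambda>i. if v i = 0 then 1 else complex_of_real (cmod (v i)) / v i)"
    have e: "cmod (e i) = 1" "e i * v i = cmod (v i)" for i
      by (simp_all add: e_def norm_divide)
    let ?l = "\<lambda>i. e i * l i"
    have "\<phi> (tensor_sum U n ?l x y) = (\<Sum>i<n. \<phi> (?l i *\<^sub>C delta_tensor U (x i) (y i)))"
      using x by (intro functional_tensor_sum[OF \<phi>]) auto
    also have "\<dots> = (\<Sum>i<n. complex_of_real (cmod (v i)))"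
    proof (rule sum.cong)
      fix i assume "i \<in> {..<n}"
      then have "\<phi> (?l i *\<^sub>C delta_tensor U (x i) (y i)) = e i * v i"
        using x by (simp add: functional_scaleC[OF \<phi>] v_def mult.assoc)
      then show "\<phi> (?l i *\<^sub>C delta_tensor U (x i) (y i)) = complex_of_real (cmod (v i))"
        by (simp only: e)
    qed simp
    finally have "(\<Sum>i<n. cmod (v i)) = cmod (\<phi> (tensor_sum U n ?l x y))"
      by (simp add: sum_nonneg flip: of_real_sum)
    also have "\<dots> \<le> C * chevet_saphar p U (tensor_sum U n ?l x y)"
      using bound x tensor_sum_mem by blast
    also have "\<dots> \<le> C * (lp_norm p n ?l * weak_lp_norm (conj_index p) n y)"
      using C x by (intro mult_left_mono chevet_saphar_le) auto
    also have "lp_norm p n ?l = lp_norm p n l"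
      by (simp add: lp_norm_def norm_mult e)
    finally show "(\<Sum>i<n. cmod (\<phi> (l i *\<^sub>C delta_tensor U (x i) (y i))))
        \<le> C * (lp_norm p n l * weak_lp_norm (conj_index p) n y)" by (simp add: v_def)
  qed
next
  assume dom: "abs_dominated U \<phi> C p"
  show "\<forall>u\<in>Delta_tensor U. cmod (\<phi> u) \<le> C * chevet_saphar p U u"
  proof
    fix u :: "('a \<Rightarrow> ('b \<Rightarrow>\<^sub>L complex)) \<Rightarrow> complex" assume u: "u \<in> Delta_tensor U"
    have "cmod (\<phi> u) / C \<le> chevet_saphar p U u"
      unfolding chevet_saphar_def
    proof (rule cInf_greatest)
      show "{lp_norm p n l * weak_lp_norm (conj_index p) n y |n l x y.
          (\<forall>i<n. x i \<in> U) \<and> u = tensor_sum U n l x y} \<noteq> {}"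
        using Delta_tensor_representation[OF u] by blast
    next
      fix r assume "r \<in> {lp_norm p n l * weak_lp_norm (conj_index p) n y |n l x y.
          (\<forall>i<n. x i \<in> U) \<and> u = tensor_sum U n l x y}"
      then obtain n l x y where r: "r = lp_norm p n l * weak_lp_norm (conj_index p) n y"
        and x: "\<forall>i<n. x i \<in> U" and rep: "u = tensor_sum U n l x y" by blast
      have "\<phi> u = (\<Sum>i<n. \<phi> (l i *\<^sub>C delta_tensor U (x i) (y i)))"
        unfolding rep using x by (intro functional_tensor_sum[OF \<phi>]) auto
      then have "cmod (\<phi> u) \<le> (\<Sum>i<n. cmod (\<phi> (l i *\<^sub>C delta_tensor U (x i) (y i))))"
        by (simp add: norm_sum)
      also have "\<dots> \<le> C * r"
        using dom x unfolding abs_dominated_def r by blast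
      finally show "cmod (\<phi> u) / C \<le> r" using C by (simp add: field_simps)
    qed
    then show "cmod (\<phi> u) \<le> C * chevet_saphar p U u" using C by (simp add: field_simps)
  qed
qed

section \<open>The dominating measure\<close>

lemma continuous_map_weak_star_powr:
  assumes "0 < q"
  shows "continuous_map weak_star_ball euclidean (\<lambda>g. cmod (blinfun_apply g (y::'b::complex_normed_vector)) powr q)"
proof -
  have "continuous_map euclidean euclidean (\<lambda>z::complex. cmod z powr q)"
    unfolding continuous_map_iff_continuous2
    by (rule continuous_on_powr'[OF continuous_on_norm_id continuous_on_const]) (use assms in auto)
  from continuous_map_compose[OF continuous_map_weak_star_eval this] show ?thesis
    by (simp add: o_def)
qed

lemma measure_imp_abs_dominated:
  fixes \<phi> :: "(('a::complex_normed_vector \<Rightarrow> ('b::complex_normed_vector \<Rightarrow>\<^sub>L complex)) \<Rightarrow> complex) \<Rightarrow> complex"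
  assumes C: "0 < C" and p: "1 < p"
    and \<mu>: "regular_borel_prob weak_star_ball \<mu>"
    and le: "\<forall>c. \<forall>x\<in>U. \<forall>y. cmod (\<phi> (c *\<^sub>C delta_tensor U x y)) \<le> C * cmod c * Lq_norm \<mu> (conj_index p) y"
  shows "abs_dominated U \<phi> C p"
  unfolding abs_dominated_def
proof (intro allI impI)
  fix n l and x :: "nat \<Rightarrow> 'a" and y :: "nat \<Rightarrow> 'b" assume x: "\<forall>i<n. x i \<in> U"
  interpret prob_space \<mu> using \<mu> by (simp add: regular_borel_prob_def)
  define q where "q = enn2real (conj_index p)"
  have q: "1 \<le> q" using conj_index_ge_1[OF p] by (simp add: q_def)
  let ?W = "weak_lp_norm (conj_index p) n y"
  have int: "integrable \<mu> (\<lambda>g. cmod (blinfun_apply g (y i)) powr q)" for i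
    using q by (intro integrable_continuous_map[OF \<mu> compact_weak_star_ball]
        continuous_map_weak_star_powr) auto
  have Lq: "Lq_norm \<mu> (conj_index p) (y i) powr q = (LINT g|\<mu>. cmod (blinfun_apply g (y i)) powr q)" for i
    using q by (simp add: Lq_norm_def powr_powr flip: q_def)
  have bound: "(\<Sum>i<n. cmod (blinfun_apply g (y i)) powr q) \<le> ?W powr q" if "g \<in> space \<mu>" for g
  proof -
    have "g \<in> cdual_ball" using that \<mu> by (simp add: regular_borel_prob_def topspace_weak_star_ball)
    then have "lp_norm (conj_index p) n (\<lambda>i. blinfun_apply g (y i)) \<le> ?W"
      unfolding weak_lp_norm_def by (rule cSUP_upper[OF _ bdd_above_weak_lp_norm])
    then have "(\<Sum>i<n. cmod (blinfun_apply g (y i)) powr q) powr (1 / q) \<le> ?W"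
      by (simp add: lp_norm_def conj_index_neq_top[OF p] q_def)
    then have "((\<Sum>i<n. cmod (blinfun_apply g (y i)) powr q) powr (1 / q)) powr q \<le> ?W powr q"
      using q by (intro powr_mono2) auto
    then show ?thesis using q by (simp add: powr_powr sum_nonneg)
  qed
  have "(\<Sum>i<n. cmod (\<phi> (l i *\<^sub>C delta_tensor U (x i) (y i))))
      \<le> (\<Sum>i<n. C * (cmod (l i) * Lq_norm \<mu> (conj_index p) (y i)))"
    using le x by (intro sum_mono) (auto simp: mult.assoc)
  also have "\<dots> = C * (\<Sum>i<n. cmod (l i) * Lq_norm \<mu> (conj_index p) (y i))"
    by (simp add: sum_distrib_left)
  also have "\<dots> \<le> C * (lp_norm p n l * (\<Sum>i<n. Lq_norm \<mu> (conj_index p) (y i) powr q) powr (1 / q))"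
    unfolding q_def using C by (intro mult_left_mono lp_norm_Holder p) (auto simp: Lq_norm_def)
  also have "(\<Sum>i<n. Lq_norm \<mu> (conj_index p) (y i) powr q)
      = (LINT g|\<mu>. (\<Sum>i<n. cmod (blinfun_apply g (y i)) powr q))"
    using int by (simp add: Lq)
  also have "C * (lp_norm p n l * \<dots> powr (1 / q)) \<le> C * (lp_norm p n l * (?W powr q) powr (1 / q))"
    using C q int
    by (intro mult_left_mono powr_mono2 integral_le_const AE_I2 bound Bochner_Integration.integrable_sum
        Bochner_Integration.integral_nonneg sum_nonneg lp_norm_nonneg) auto
  also have "(?W powr q) powr (1 / q) = ?W"
    using q by (simp add: powr_powr weak_lp_norm_nonneg)
  finally show "(\<Sum>i<n. cmod (\<phi> (l i *\<^sub>C delta_tensor U (x i) (y i))))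
      \<le> C * (lp_norm p n l * ?W)" .
qed

text \<open>The nonnegative coefficients \<open>t\<close> are absorbed into the vectors, which are multiplied by \<open>t\<^bsup>1/q\<^esup>\<close>, as both
  sides are homogeneous of degree \<open>q\<close>. With \<open>a\<^sub>i = |\<phi>(\<delta>(x\<^sub>i) \<otimes> y\<^sub>i)|\<close> and \<open>S = \<Sum> a\<^sub>i\<^sup>q\<close>, testing
  the sum estimate on the weights \<open>a\<^sub>i\<^bsup>q-1\<^esup>\<close> gives \<open>S \<le> C S\<^bsup>1-1/q\<^esup> w\<close> for the weak norm \<open>w\<close>, that is,
  \<open>S \<le> C\<^sup>q w\<^sup>q\<close>. By weak* compactness the supremum that defines \<open>w\<close> is attained.\<close>

lemma abs_dominated_pointwise:
  fixes \<phi> :: "(('a::complex_normed_vector \<Rightarrow> ('b::complex_normed_vector \<Rightarrow>\<^sub>L complex)) \<Rightarrow> complex) \<Rightarrow> complex"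
  assumes \<phi>: "clinear_on (Delta_tensor U) \<phi>" and C: "0 < C" and p: "1 < p"
    and dom: "abs_dominated U \<phi> C p"
    and J: "finite J" "J \<subseteq> U \<times> UNIV" and t: "\<And>j. 0 \<le> t j"
  defines "q \<equiv> enn2real (conj_index p)"
  shows "\<exists>g\<in>cdual_ball. (\<Sum>j\<in>J. t j * (cmod (\<phi> (delta_tensor U (fst j) (snd j))) / C) powr q)
      \<le> (\<Sum>j\<in>J. t j * cmod (blinfun_apply g (snd j)) powr q)"
proof -
  have q: "1 \<le> q" using conj_index_ge_1[OF p] by (simp add: q_def)
  obtain e where e: "bij_betw e {..<card J} J"
    using ex_bij_betw_nat_finite[OF J(1)] by (auto simp: atLeast0LessThan)
  define n where "n = card J"
  define x where "x = (\<lambda>i. fst (e i))"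
  define y where "y = (\<lambda>i. (t (e i) powr (1 / q)) *\<^sub>R snd (e i))"
  define a where "a = (\<lambda>i. cmod (\<phi> (delta_tensor U (x i) (y i))))"
  have x: "x i \<in> U" if "i < n" for i
    using bij_betwE[OF e] J that by (force simp: x_def n_def)
  define S where "S = (\<Sum>i<n. a i powr q)"
  define F where "F = (\<lambda>g. \<Sum>i<n. cmod (blinfun_apply g (y i)) powr q)"
  have S: "(\<Sum>j\<in>J. t j * (cmod (\<phi> (delta_tensor U (fst j) (snd j))) / C) powr q) = S / C powr q"
  proof -
    have "t (e i) * (cmod (\<phi> (delta_tensor U (fst (e i)) (snd (e i)))) / C) powr q = a i powr q / C powr q"
      if "i < n" for i
      using x[OF that, unfolded x_def] q C t
      by (simp add: a_def x_def y_def delta_tensor_scaleR functional_scaleC[OF \<phi>] norm_mult powr_mult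
          powr_powr powr_divide)
    then show ?thesis
      unfolding S_def n_def sum_divide_distrib sum.reindex_bij_betw[OF e, symmetric]
      by (intro sum.cong) auto
  qed
  have F: "(\<Sum>j\<in>J. t j * cmod (blinfun_apply g (snd j)) powr q) = F g" for g
    unfolding F_def n_def sum.reindex_bij_betw[OF e, symmetric]
    using t q by (intro sum.cong) (simp_all add: y_def blinfun.scaleR_right powr_mult powr_powr)
  have "continuous_map weak_star_ball euclidean F"
    unfolding F_def using q by (intro continuous_map_sum continuous_map_weak_star_powr) auto
  then have "compact (F ` cdual_ball)"
    using image_compactin[OF _ \<open>continuous_map weak_star_ball euclidean F\<close>, of cdual_ball] compact_weak_star_ball
    by (simp add: compact_space_def topspace_weak_star_ball)
  then obtain g where g: "g \<in> cdual_ball" and max: "\<And>h. h \<in> cdual_ball \<Longrightarrow> F h \<le> F g"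
    using compact_attains_sup[of "F ` cdual_ball"] zero_mem_cdual_ball by blast
  have Fg: "0 \<le> F g" by (simp add: F_def sum_nonneg)
  have "S / C powr q \<le> F g"
  proof (cases "S = 0")
    case False
    then have pos: "0 < S" by (simp add: S_def sum_nonneg less_le)
    have W: "weak_lp_norm (conj_index p) n y \<le> F g powr (1 / q)"
      unfolding weak_lp_norm_def
    proof (rule cSUP_least)
      fix h :: "'b \<Rightarrow>\<^sub>L complex" assume "h \<in> cdual_ball"
      then have "F h powr (1 / q) \<le> F g powr (1 / q)"
        using q max by (intro powr_mono2) (auto simp: F_def sum_nonneg)
      then show "lp_norm (conj_index p) n (\<lambda>i. blinfun_apply h (y i)) \<le> F g powr (1 / q)"
        by (simp add: lp_norm_def conj_index_neq_top[OF p] F_def q_def)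
    qed (use zero_mem_cdual_ball in auto)
    let ?l = "\<lambda>i. complex_of_real (a i powr (q - 1))"
    have "S = (\<Sum>i<n. cmod (\<phi> (?l i *\<^sub>C delta_tensor U (x i) (y i))))"
      unfolding S_def
    proof (rule sum.cong)
      fix i assume "i \<in> {..<n}"
      then have "cmod (\<phi> (?l i *\<^sub>C delta_tensor U (x i) (y i))) = a i powr (q - 1) * a i"
        using x by (simp add: functional_scaleC[OF \<phi>] norm_mult a_def)
      also have "\<dots> = a i powr q"
        by (cases "a i = 0") (auto simp: a_def powr_diff)
      finally show "a i powr q = cmod (\<phi> (?l i *\<^sub>C delta_tensor U (x i) (y i)))" ..
    qed simp
    also have "\<dots> \<le> C * (lp_norm p n ?l * weak_lp_norm (conj_index p) n y)"
      by (rule dom[unfolded abs_dominated_def, rule_format]) (rule x)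
    also have "\<dots> \<le> C * (S powr (1 - 1 / q) * F g powr (1 / q))"
      using C W pos lp_norm_dual_weights[OF p, of n a]
      by (intro mult_left_mono mult_mono) (auto simp: S_def q_def a_def weak_lp_norm_nonneg)
    also have "\<dots> = S / S powr (1 / q) * (C * F g powr (1 / q))"
      using pos by (simp add: powr_diff)
    finally have "S powr (1 / q) \<le> C * F g powr (1 / q)"
      using pos by (simp add: field_simps)
    then have "(S powr (1 / q)) powr q \<le> (C * F g powr (1 / q)) powr q"
      using q by (intro powr_mono2) auto
    then have "S \<le> C powr q * F g"
      using q pos C Fg by (simp add: powr_powr powr_mult)
    then show ?thesis using C by (simp add: field_simps)
  qed (use Fg in simp)
  then show ?thesis using g by (auto simp: S F)
qed

lemma abs_dominated_imp_measure:
  fixes \<phi> :: "(('a::complex_normed_vector \<Rightarrow> ('b::complex_normed_vector \<Rightarrow>\<^sub>L complex)) \<Rightarrow> complex) \<Rightarrow> complex"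
  assumes \<phi>: "clinear_on (Delta_tensor U) \<phi>" and C: "0 < C" and p: "1 < p"
    and dom: "abs_dominated U \<phi> C p"
  shows "\<exists>\<mu>. regular_borel_prob weak_star_ball \<mu> \<and>
    (\<forall>c. \<forall>x\<in>U. \<forall>y. cmod (\<phi> (c *\<^sub>C delta_tensor U x y)) \<le> C * cmod c * Lq_norm \<mu> (conj_index p) y)"
proof -
  define q where "q = enn2real (conj_index p)"
  have q: "1 \<le> q" using conj_index_ge_1[OF p] by (simp add: q_def)
  have "\<exists>\<mu>. regular_borel_prob weak_star_ball \<mu> \<and> (\<forall>j\<in>U \<times> UNIV.
      (cmod (\<phi> (delta_tensor U (fst j) (snd j))) / C) powr q
        \<le> (LINT g|\<mu>. cmod (blinfun_apply g (snd j)) powr q))"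
    using q abs_dominated_pointwise[OF \<phi> C p dom] zero_mem_cdual_ball
    by (intro regular_measure_domination compact_weak_star_ball Hausdorff_weak_star_ball
        continuous_map_weak_star_powr) (auto simp: topspace_weak_star_ball q_def)
  then obtain \<mu> where \<mu>: "regular_borel_prob weak_star_ball \<mu>"
    and le: "\<And>x y. x \<in> U \<Longrightarrow> (cmod (\<phi> (delta_tensor U x y)) / C) powr q
        \<le> (LINT g|\<mu>. cmod (blinfun_apply g y) powr q)"
    by auto
  have "cmod (\<phi> (c *\<^sub>C delta_tensor U x y)) \<le> C * cmod c * Lq_norm \<mu> (conj_index p) y"
    if x: "x \<in> U" for c x y
  proof -
    have "((cmod (\<phi> (delta_tensor U x y)) / C) powr q) powr (1 / q) \<le> Lq_norm \<mu> (conj_index p) y"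
      unfolding Lq_norm_def using q le[OF x] by (auto simp flip: q_def intro: powr_mono2)
    then have "cmod (\<phi> (delta_tensor U x y)) / C \<le> Lq_norm \<mu> (conj_index p) y"
      using q C by (simp add: powr_powr)
    then have "cmod (\<phi> (delta_tensor U x y)) \<le> C * Lq_norm \<mu> (conj_index p) y"
      using C by (simp add: field_simps)
    then have "cmod c * cmod (\<phi> (delta_tensor U x y)) \<le> cmod c * (C * Lq_norm \<mu> (conj_index p) y)"
      by (rule mult_left_mono) simp
    then show ?thesis
      using x by (simp add: functional_scaleC[OF \<phi>] norm_mult mult_ac)
  qed
  with \<mu> show ?thesis by blast
qed

text \<open>Quantifying over \<open>u\<close> together with its representations is the same as quantifying over all
  representations, which brings the second condition into the form \<open>abs_dominated\<close>.\<close>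

theorem theorem5p1:
  fixes U :: "'a::complex_banach set"
    and \<phi> :: "(('a \<Rightarrow> ('b::complex_banach \<Rightarrow>\<^sub>L complex)) \<Rightarrow> complex) \<Rightarrow> complex"
    and C :: real and p :: ennreal
  assumes "open U"
    and "clinear_on (Delta_tensor U) \<phi>"
    and "C > 0"
    and "1 < p"
  shows
    "((\<forall>u\<in>Delta_tensor U. cmod (\<phi> u) \<le> C * chevet_saphar p U u)
      \<longleftrightarrow>
      (\<forall>u\<in>Delta_tensor U. \<forall>n l x y.
         (\<forall>i<n. x i \<in> U) \<and> u = tensor_sum U n l x y \<longrightarrow>
         (\<Sum>i<n. cmod (\<phi> (l i *\<^sub>C delta_tensor U (x i) (y i))))
           \<le> C * (lp_norm p n l * weak_lp_norm (conj_index p) n y)))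
     \<and>
     ((\<forall>u\<in>Delta_tensor U. \<forall>n l x y.
         (\<forall>i<n. x i \<in> U) \<and> u = tensor_sum U n l x y \<longrightarrow>
         (\<Sum>i<n. cmod (\<phi> (l i *\<^sub>C delta_tensor U (x i) (y i))))
           \<le> C * (lp_norm p n l * weak_lp_norm (conj_index p) n y))
      \<longleftrightarrow>
      (\<exists>\<mu>. regular_borel_prob weak_star_ball \<mu> \<and>
         (\<forall>c. \<forall>x\<in>U. \<forall>y. cmod (\<phi> (c *\<^sub>C delta_tensor U x y))
            \<le> C * cmod c * Lq_norm \<mu> (conj_index p) y)))"
proof -
  have dom: "(\<forall>u\<in>Delta_tensor U. \<forall>n l x y.
         (\<forall>i<n. x i \<in> U) \<and> u = tensor_sum U n l x y \<longrightarrow>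
         (\<Sum>i<n. cmod (\<phi> (l i *\<^sub>C delta_tensor U (x i) (y i))))
           \<le> C * (lp_norm p n l * weak_lp_norm (conj_index p) n y)) \<longleftrightarrow> abs_dominated U \<phi> C p"
    unfolding abs_dominated_def using tensor_sum_mem by blast
  show ?thesis
    unfolding dom
    using chevet_saphar_bound_iff[OF assms(2,3)] abs_dominated_imp_measure[OF assms(2-4)]
      measure_imp_abs_dominated[OF assms(3,4)]
    by blast
qed

end
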